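(* Let $\mathcal{P}$ be a basic cell of a lattice $\mathbf{G}\mathbb{Z}^n$ ($\mathbf{G}\in\mathbb{R}^{n\times n}$ full-rank), let $\mathcal{A}\subseteq\mathcal{P}$ with $\mu(\mathcal{A})>0$, and consider the rejection-sampled universal quantizer (RSUQ) $(P_S,Q_{\mathcal{A},\mathcal{P}})$ for $\mathcal{A}$ against $\mathcal{P}$. Let $d:\mathbb{R}^n\to[0,\infty)$ be a distortion function. For a random input $\mathbf{X}\in\mathbb{R}^n$ following any distribution, independent of $S\sim P_S$, the conditional entropy of the quantizer satisfies \[ H(Q_{\mathcal{A},\mathcal{P}}(\mathbf{X},S)\,|\,S)\le R(D)-\log p+C(D)+\log e, \] where $p:=\mu(\mathcal{A})/\mu(\mathcal{P})$, $D:=\mathbb{E}[d(Q_{\mathcal{A},\mathcal{P}}(\mathbf{X},S)-\mathbf{X})]$ is the expected distortion of the RSUQ, \[ R(D):=\inf_{P_{\hat{\mathbf{X}}|\mathbf{X}}:\,\mathbb{E}[d(\hat{\mathbf{X}}-\mathbf{X})]\le D}I(\mathbf{X};\hat{\mathbf{X}}) \] is the rate-distortion function, and \[ C(D):=\sup_{P_{\mathbf{T}}:\,\mathbb{E}[d(-\mathbf{T})]\le D}I(\mathbf{T};\mathbf{T}+\mathbf{Z}), \] where the supremum is over distributions $P_{\mathbf{T}}$ on $\mathbb{R}^n$ (with $\mathbf{T}\sim P_{\mathbf{T}}$) satisfying $\mathbb{E}[d(-\mathbf{T})]\le D$, and $\mathbf{Z}\sim\mathrm{Unif}(\mathcal{A})$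 is independent of $\mathbf{T}$.
   Context: Conventions: $\log$ is to base $2$; $H(\cdot|\cdot)$ is conditional Shannon entropy and $I(\cdot;\cdot)$ mutual information, in bits; $\mu$ is Lebesgue measure on $\mathbb{R}^n$; sets and functions are measurable. A bounded set $\mathcal{P}\subseteq\mathbb{R}^n$ is a basic cell of $\mathbf{G}\mathbb{Z}^n$ if the translates $(\mathcal{P}+\mathbf{G}\mathbf{j})_{\mathbf{j}\in\mathbb{Z}^n}$ partition $\mathbb{R}^n$. For a basic cell $\mathcal{P}$, $Q_{\mathcal{P}}(\mathbf{x})$ is the unique lattice point $\mathbf{y}\in\mathbf{G}\mathbb{Z}^n$ with $\mathbf{x}\in-\mathcal{P}+\mathbf{y}$. RSUQ for $\mathcal{A}$ against $\mathcal{P}$: the state is $S=(\mathbf{V}_i)_{i\ge1}$ with $\mathbf{V}_1,\mathbf{V}_2,\ldots$ i.i.d. $\mathrm{Unif}(\mathcal{P})$, and $Q_{\mathcal{A},\mathcal{P}}(\mathbf{x},(\mathbf{v}_i)_i)=Q_{\mathcal{P}}(\mathbf{x}-\mathbf{v}_k)+\mathbf{v}_k$, where $k=\min\{i:Q_{\mathcal{P}}(\mathbf{x}-\mathbf{v}_i)+\mathbf{v}_i-\mathbf{x}\in\mathcal{A}\}$ (which exists almost surely for each fixed $\mathbf{x}$). *)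

theory Defs
  imports "HOL-Probability.Probability"
begin

section \<open>Information measures in bits, with extended values\<close>

text \<open>The joint law of a pair whose first component has law \<open>L\<close> and whose second component has
  conditional law \<open>K x\<close> given that the first one is \<open>x\<close>.\<close>

definition joint_law :: "'a measure \<Rightarrow> 'b measure \<Rightarrow> ('a \<Rightarrow> 'b measure) \<Rightarrow> ('a \<times> 'b) measure" where
  "joint_law L N K = L \<bind> (\<lambda>x. K x \<bind> (\<lambda>y. return (L \<Otimes>\<^sub>M N) (x, y)))"

text \<open>The library's \<^const>\<open>KL_divergence\<close> is real-valued and returns a meaningless value
  when the divergence of \<open>N\<close> from \<open>M\<close> is infinite. For probability measures with
  \<open>N\<close> absolutely continuous with respect to \<open>M\<close>, the negative part of the log-density is always
  \<open>N\<close>-integrable, so non-integrability means that the divergence is \<open>\<infinity>\<close>.\<close>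

definition kl_div :: "'a measure \<Rightarrow> 'a measure \<Rightarrow> ereal" where
  "kl_div M N =
     (if absolutely_continuous M N \<and> integrable N (entropy_density 2 M N)
      then ereal (KL_divergence 2 M N) else \<infinity>)"

definition mutual_info ::
  "'w measure \<Rightarrow> 'a measure \<Rightarrow> 'b measure \<Rightarrow> ('w \<Rightarrow> 'a) \<Rightarrow> ('w \<Rightarrow> 'b) \<Rightarrow> ereal" where
  "mutual_info M S T X Y =
     kl_div (distr M S X \<Otimes>\<^sub>M distr M T Y) (distr M (S \<Otimes>\<^sub>M T) (\<lambda>\<omega>. (X \<omega>, Y \<omega>)))"

text \<open>Shannon entropy of a law; it is \<open>\<infinity>\<close> for a law that is not discrete.\<close>

definition shannon_entropy :: "'a measure \<Rightarrow> ennreal" where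
  "shannon_entropy N =
     (if \<exists>C. countable C \<and> (AE x in N. x \<in> C)
      then \<integral>\<^sup>+x. ennreal (- measure N {x} * log 2 (measure N {x})) \<partial>count_space (space N)
      else \<infinity>)"

text \<open>Regular conditional distributions of \<open>U\<close> given \<open>V\<close>.\<close>

definition cond_laws ::
  "'w measure \<Rightarrow> 's measure \<Rightarrow> ('w \<Rightarrow> 'a::polish_space) \<Rightarrow> ('w \<Rightarrow> 's) \<Rightarrow> ('s \<Rightarrow> 'a measure) set" where
  "cond_laws M L U V =
     {K \<in> measurable L (prob_algebra borel).
        distr M (L \<Otimes>\<^sub>M borel) (\<lambda>\<omega>. (V \<omega>, U \<omega>)) = joint_law (distr M L V) borel K}"

text \<open>\<open>H(U | V)\<close> is the mean over \<open>v\<close> of the entropy of the conditional law of \<open>U\<close> given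
  \<open>V = v\<close>. On a Polish space a regular conditional distribution exists and any two of them agree
  for almost every \<open>v\<close>, so the infimum is over a one-element set of values: it only
  serves to select this value.\<close>

definition cond_entropy ::
  "'w measure \<Rightarrow> 's measure \<Rightarrow> ('w \<Rightarrow> 'a::polish_space) \<Rightarrow> ('w \<Rightarrow> 's) \<Rightarrow> ennreal" where
  "cond_entropy M L U V =
     (INF K \<in> cond_laws M L U V. \<integral>\<^sup>+v. shannon_entropy (K v) \<partial>distr M L V)"


section \<open>Rate-distortion function and the capacity term\<close>

text \<open>The distortion level ranges over \<^typ>\<open>ennreal\<close>, since an expected distortion may be \<open>\<infinity>\<close>.
  The first argument is the law of the source.\<close>

definition rate_distortion ::
  "(real^'n) measure \<Rightarrow> (real^'n \<Rightarrow> real) \<Rightarrow> ennreal \<Rightarrow> ereal" where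
  "rate_distortion PX d D =
     (INF K \<in> {K \<in> measurable borel (prob_algebra borel).
                 (\<integral>\<^sup>+z. ennreal (d (snd z - fst z)) \<partial>joint_law PX borel K) \<le> D}.
        mutual_info (joint_law PX borel K) borel borel fst snd)"

text \<open>Here \<open>T\<close> and \<open>Z\<close> are the coordinates of the product space, hence independent.\<close>

definition capacity_term ::
  "(real^'n) set \<Rightarrow> (real^'n \<Rightarrow> real) \<Rightarrow> ennreal \<Rightarrow> ereal" where
  "capacity_term A d D =
     (SUP PT \<in> {PT. prob_space PT \<and> sets PT = sets borel \<and>
                  (\<integral>\<^sup>+t. ennreal (d (- t)) \<partial>PT) \<le> D}.
        mutual_info (PT \<Otimes>\<^sub>M uniform_measure lborel A) borel borel fst (\<lambda>(t, z). t + z))"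


section \<open>Rejection-sampled universal quantizer\<close>

definition lattice_pt :: "real^'n^'n \<Rightarrow> int^'n \<Rightarrow> real^'n" where
  "lattice_pt G j = G *v (\<chi> i. real_of_int (j $ i))"

definition basic_cell :: "real^'n^'n \<Rightarrow> (real^'n) set \<Rightarrow> bool" where
  "basic_cell G P \<longleftrightarrow>
     bounded P \<and>
     (\<Union>j. (\<lambda>x. x + lattice_pt G j) ` P) = UNIV \<and>
     disjoint_family (\<lambda>j. (\<lambda>x. x + lattice_pt G j) ` P)"

definition cell_quantizer :: "real^'n^'n \<Rightarrow> (real^'n) set \<Rightarrow> real^'n \<Rightarrow> real^'n" where
  "cell_quantizer G P x =
     (THE y. y \<in> range (lattice_pt G) \<and> x \<in> (\<lambda>u. - u + y) ` P)"

text \<open>The shared state is a sequence of points, indexed from \<open>0\<close>. If no index is accepted,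
  which for each \<open>x\<close> has probability \<open>0\<close>, \<open>LEAST\<close> yields an unspecified index.\<close>

definition rsuq ::
  "real^'n^'n \<Rightarrow> (real^'n) set \<Rightarrow> (real^'n) set \<Rightarrow> real^'n \<Rightarrow> (nat \<Rightarrow> real^'n) \<Rightarrow> real^'n" where
  "rsuq G P A x v =
     (let k = (LEAST i. cell_quantizer G P (x - v i) + v i - x \<in> A)
      in cell_quantizer G P (x - v k) + v k)"

abbreviation state_space :: "(nat \<Rightarrow> real^'n) measure" where
  "state_space \<equiv> PiM UNIV (\<lambda>_. borel)"

definition rsuq_state :: "(real^'n) set \<Rightarrow> (nat \<Rightarrow> real^'n) measure" where
  "rsuq_state P = PiM UNIV (\<lambda>_. uniform_measure lborel P)"

end

theory Submission
  imports Defs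
begin

text \<open>Let \<open>(X, Y)\<close> be any admissible test channel, \<open>T = X - Y\<close> and \<open>f\<close> the density of \<open>T + Z\<close>.
  As in Gibbs' inequality, the law of \<open>Q\<close> given the state is compared with a guess that sees the state
  and \<open>Y\<close>: the point \<open>y\<close> of the grid \<open>v\<^sub>k + G\<int>\<^sup>n\<close> gets weight \<open>w\<^sub>k \<mu>(P) f(y - Y)\<close>, where
  \<open>w\<^sub>k\<close> is a geometric distribution on the indices. These weights have total mass \<open>1\<close> only on
  average over the state, which is enough: with \<open>g\<close> the density of \<open>(X, Y)\<close> with respect to the
  product of its marginals and \<open>\<pi>(q)\<close> the conditional probability of \<open>Q = q\<close> given the state,
  the variable \<open>W = w\<^sub>K \<mu>(P) f(Q - Y) / (\<pi>(Q) g(X, Y))\<close> has mean at most \<open>1\<close>, so that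
  \<open>ln W \<le> W - 1\<close> gives
  \<open>H(Q | S) \<le> I(X; Y) + E[- log w\<^sub>K] + log p + I(T; T + Z)\<close>, because \<open>Q - X\<close> is uniform on \<open>A\<close>
  and independent of \<open>(X, Y)\<close>. The index \<open>K\<close> has mean \<open>(1 - p) / p\<close>, and the ratio
  \<open>exp (- p)\<close> of the weights \<open>w\<^sub>k\<close> makes \<open>E[- log w\<^sub>K] \<le> log e - log p\<close>. The distortion
  level enters only through the constraint on \<open>(X, Y)\<close>, which is also the constraint on \<open>T\<close>.\<close>

section \<open>Lattice points, integrals over countable families, entropy of a discrete image
  law\<close>

lemma lattice_pt_add: "lattice_pt G (i + j) = lattice_pt G i + lattice_pt G j"
proof -
  have "(\<chi> k. real_of_int ((i + j) $ k)) = (\<chi> k. real_of_int (i $ k)) + (\<chi> k. real_of_int (j $ k))"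
    by (simp add: vec_eq_iff)
  then show ?thesis by (simp add: lattice_pt_def matrix_vector_right_distrib)
qed

lemma lattice_pt_0: "lattice_pt G 0 = 0"
  using lattice_pt_add[of G 0 0] by simp

lemma lattice_pt_minus: "lattice_pt G (- j) = - lattice_pt G j"
  using lattice_pt_add[of G "-j" j] by (simp add: lattice_pt_0 eq_neg_iff_add_eq_0)

lemma nn_integral_lborel_translate:
  fixes c :: "'a::euclidean_space"
  assumes [measurable]: "f \<in> borel_measurable borel"
  shows "(\<integral>\<^sup>+x. f (c + x) \<partial>lborel) = (\<integral>\<^sup>+x. f x \<partial>lborel)"
proof -
  have "(\<integral>\<^sup>+x. f x \<partial>lborel) = (\<integral>\<^sup>+x. f x \<partial>distr lborel borel ((+) c))"
    by (simp add: lborel_distr_plus)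
  also have "\<dots> = (\<integral>\<^sup>+x. f (c + x) \<partial>lborel)"
    by (subst nn_integral_distr) auto
  finally show ?thesis by simp
qed

text \<open>With a countable index, measurability of each section already gives joint measurability,
  which is what parametrized integrals require.\<close>

lemma borel_measurable_nn_integral_count_space:
  fixes f :: "'i::countable \<Rightarrow> 'a \<Rightarrow> ennreal"
  assumes [measurable]: "\<And>i. f i \<in> borel_measurable M"
  shows "(\<lambda>x. \<integral>\<^sup>+i. f i x \<partial>count_space UNIV) \<in> borel_measurable M"
proof -
  have "(\<lambda>z. f (snd z) (fst z)) \<in> borel_measurable (M \<Otimes>\<^sub>M count_space UNIV)"
    by (rule measurable_compose_countable[where f="\<lambda>i z. f i (fst z)"]) auto
  then show ?thesis
    by (intro sigma_finite_measure.borel_measurable_nn_integral sigma_finite_measure_count_space)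
       (simp add: case_prod_beta')
qed

text \<open>The end point \<open>x = 0\<close> is included thanks to the default value
  \<open>ln 0 = 0\<close>.\<close>

lemma log2_nonpos: "0 \<le> x \<Longrightarrow> x \<le> 1 \<Longrightarrow> log 2 x \<le> 0"
  by (cases "x = 0") (auto simp: log_def[of 2 0] less_le)

text \<open>Entropy is the mean of minus the logarithm of the probability of the fibre that contains
  the sample; the sum over values and the integral over samples are exchanged. The countable set
  \<open>C\<close> places the law in the discrete case of \<open>shannon_entropy\<close>.\<close>

lemma shannon_entropy_distr_le:
  fixes q :: "'a \<Rightarrow> 'b::{second_countable_topology, t2_space}"
  assumes N: "prob_space N" and q[measurable]: "q \<in> borel_measurable N"
    and C: "countable C" "\<And>x. x \<in> space N \<Longrightarrow> q x \<in> C"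
  shows "shannon_entropy (distr N borel q)
    \<le> (\<integral>\<^sup>+x. ennreal (- log 2 (measure N {x' \<in> space N. q x' = q x})) \<partial>N)"
proof -
  interpret prob_space N by fact
  let ?m = "\<lambda>y. measure N {x' \<in> space N. q x' = y}"
  let ?f = "\<lambda>y. ennreal (- log 2 (?m y))"
  have m: "measure (distr N borel q) {y} = ?m y" for y
    by (subst measure_distr) (auto intro!: arg_cong[where f="measure N"])
  have CN: "AE y in distr N borel q. y \<in> C"
  proof (subst AE_distr_iff)
    show "{y \<in> space borel. y \<in> C} \<in> sets borel"
      using sets.countable[of C borel] C by simp
  qed (use C in auto)
  have m0: "?m y = 0" if "y \<notin> C" for y
  proof -
    have "{x' \<in> space N. q x' = y} = {}" using C that by auto
    then show ?thesis by (simp only: measure_empty)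
  qed
  \<comment> \<open>\<open>ennreal\<close> truncates negative numbers at 0, so the factors can be
    separated because the logarithm is not positive; at mass 0 both sides vanish.\<close>
  have summand: "ennreal (- (?m y * log 2 (?m y))) = ennreal (?m y) * ?f y" for y
  proof (cases "?m y = 0")
    case False
    then have "log 2 (?m y) \<le> 0" using measure_nonneg[of N] by (auto simp: less_le)
    then show ?thesis
      by (subst ennreal_mult[symmetric]) auto
  qed simp
  have "shannon_entropy (distr N borel q) = (\<integral>\<^sup>+y. ennreal (?m y) * ?f y \<partial>count_space UNIV)"
    unfolding shannon_entropy_def m using C CN by (auto simp: summand)
  also have "\<dots> = (\<integral>\<^sup>+y. ennreal (?m y) * ?f y \<partial>count_space C)"
    using m0 by (intro nn_integral_count_space_eq) auto
  also have "\<dots> = (\<integral>\<^sup>+y. \<integral>\<^sup>+x. ?f y * indicator {x' \<in> space N. q x' = y} x \<partial>N \<partial>count_space C)"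
    by (intro nn_integral_cong, subst nn_integral_cmult_indicator)
       (simp_all add: emeasure_eq_measure mult.commute)
  also have "\<dots> = (\<integral>\<^sup>+x. \<integral>\<^sup>+y. ?f y * indicator {x' \<in> space N. q x' = y} x \<partial>count_space C \<partial>N)"
    using C by (intro nn_integral_count_space_nn_integral[symmetric]) auto
  also have "\<dots> \<le> (\<integral>\<^sup>+x. ?f (q x) \<partial>N)"
  proof (intro nn_integral_mono)
    fix x assume x: "x \<in> space N"
    have "(\<integral>\<^sup>+y. ?f y * indicator {x' \<in> space N. q x' = y} x \<partial>count_space C)
        = (\<integral>\<^sup>+y. ?f (q x) * indicator {q x} y \<partial>count_space C)"
      using x by (intro nn_integral_cong) (auto simp: indicator_def)
    also have "\<dots> = ?f (q x)"
      using C x by (subst nn_integral_cmult_indicator) auto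
    finally show "(\<integral>\<^sup>+y. ?f y * indicator {x' \<in> space N. q x' = y} x \<partial>count_space C) \<le> ?f (q x)"
      by simp
  qed
  finally show ?thesis .
qed

section \<open>Lattice cells and rejection sampling\<close>

locale rsuq_setup =
  fixes G :: "real^'n^'n" and P A :: "(real^'n) set"
  assumes cell: "basic_cell G P"
    and P_borel[measurable]: "P \<in> sets borel"
    and A_sub: "A \<subseteq> P"
    and A_borel[measurable]: "A \<in> sets borel"
    and A_pos: "emeasure lborel A > 0"
begin

section \<open>The cell as a fundamental domain, its quantizer and the dithered error\<close>

lemma P_finite: "emeasure lborel P < \<infinity>"
  using cell emeasure_bounded_finite by (auto simp: basic_cell_def)

lemma P_pos: "emeasure lborel P > 0"
  using emeasure_mono[OF A_sub, of lborel] A_pos by (auto intro: less_le_trans)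

lemma A_finite: "emeasure lborel A < \<infinity>"
  using emeasure_mono[OF A_sub, of lborel] P_finite by (auto intro: le_less_trans)

text \<open>The tiling seen from one point: covering gives existence and disjointness gives
  uniqueness. The family of translates is indexed by integer vectors, so the index itself is unique
  and not only the lattice point.\<close>

lemma ex1_translate: "\<exists>!j. u + lattice_pt G j \<in> P"
proof -
  have un: "(\<Union>j. (\<lambda>x. x + lattice_pt G j) ` P) = UNIV"
    and dj: "disjoint_family (\<lambda>j. (\<lambda>x. x + lattice_pt G j) ` P)"
    using cell by (auto simp: basic_cell_def)
  from un obtain j x where "u = x + lattice_pt G j" "x \<in> P" by blast
  then have ex: "u + lattice_pt G (- j) \<in> P" by (simp add: lattice_pt_minus)
  have uniq: "i = k" if "u + lattice_pt G i \<in> P" "u + lattice_pt G k \<in> P" for i k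
  proof -
    have mem: "u \<in> (\<lambda>x. x + lattice_pt G (- l)) ` P" if "u + lattice_pt G l \<in> P" for l
      using that by (intro image_eqI[where x="u + lattice_pt G l"]) (auto simp: lattice_pt_minus)
    have "u \<in> (\<lambda>x. x + lattice_pt G (- i)) ` P \<inter> (\<lambda>x. x + lattice_pt G (- k)) ` P"
      by (intro IntI mem that)
    then have "- i = - k"
      using disjoint_family_onD[OF dj UNIV_I UNIV_I, of "- i" "- k"] by auto
    then show ?thesis by (simp only: neg_equal_iff_equal)
  qed
  from ex uniq show ?thesis by blast
qed

lemma sum_indicator_translates:
  "(\<integral>\<^sup>+j. indicator P (u + lattice_pt G j) \<partial>count_space UNIV) = (1::ennreal)"
proof -
  obtain k where k: "\<And>j. u + lattice_pt G j \<in> P \<longleftrightarrow> j = k"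
    using ex1_translate by metis
  then have "(indicator P (u + lattice_pt G j) :: ennreal) = indicator {k} j" for j
    by (auto simp: indicator_def)
  then have "(\<integral>\<^sup>+j. indicator P (u + lattice_pt G j) \<partial>count_space UNIV) =
      (\<integral>\<^sup>+j. indicator {k} j \<partial>count_space UNIV)"
    by (intro nn_integral_cong) auto
  then show ?thesis by simp
qed

lemma cell_quantizer_eq: "lattice_pt G j - x \<in> P \<Longrightarrow> cell_quantizer G P x = lattice_pt G j"
  unfolding cell_quantizer_def
proof (rule the_equality)
  assume j: "lattice_pt G j - x \<in> P"
  then show "lattice_pt G j \<in> range (lattice_pt G) \<and> x \<in> (\<lambda>u. - u + lattice_pt G j) ` P"
    by (auto intro!: image_eqI[where x="lattice_pt G j - x"])
  fix y assume "y \<in> range (lattice_pt G) \<and> x \<in> (\<lambda>u. - u + y) ` P"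
  then obtain i u where "y = lattice_pt G i" "u \<in> P" "x = - u + y" by auto
  moreover from this have "- x + lattice_pt G i = u" by simp
  ultimately have "y = lattice_pt G i" "- x + lattice_pt G i \<in> P" by simp_all
  moreover have "- x + lattice_pt G j \<in> P" using j by (simp add: algebra_simps)
  ultimately show "y = lattice_pt G j" using ex1_translate[of "- x"] by metis
qed

lemma cell_quantizer_cases:
  obtains j where "cell_quantizer G P x = lattice_pt G j" "lattice_pt G j - x \<in> P"
proof -
  obtain j where "- x + lattice_pt G j \<in> P" using ex1_translate[of "- x"] by blast
  then have "lattice_pt G j - x \<in> P" by (simp add: algebra_simps)
  with cell_quantizer_eq[OF this] that show ?thesis by blast
qed

text \<open>The quantizer has countably many values, and its fibre over a lattice point is a
  reflected translate of the cell.\<close>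

lemma measurable_cell_quantizer[measurable]: "cell_quantizer G P \<in> borel_measurable borel"
proof (rule borel_measurableI)
  fix B :: "(real^'n) set"
  have "cell_quantizer G P -` B =
      (\<Union>j\<in>{j. lattice_pt G j \<in> B}. {x. lattice_pt G j - x \<in> P})"
  proof (intro equalityI subsetI)
    fix x assume "x \<in> cell_quantizer G P -` B"
    then show "x \<in> (\<Union>j\<in>{j. lattice_pt G j \<in> B}. {x. lattice_pt G j - x \<in> P})"
      by (cases rule: cell_quantizer_cases[of x]) auto
  qed (auto dest: cell_quantizer_eq)
  then show "cell_quantizer G P -` B \<inter> space borel \<in> sets borel"
    by (auto intro!: sets.countable_UN')
qed

text \<open>Unfolding over a fundamental domain: the translates of the cell cover the space exactly
  once, so periodizing \<open>f\<close> and integrating over \<open>P\<close> recovers the full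
  integral, whatever the shift \<open>c\<close>.\<close>

lemma unfolding_integral:
  fixes f :: "real^'n \<Rightarrow> ennreal"
  assumes [measurable]: "f \<in> borel_measurable borel"
  shows "(\<integral>\<^sup>+v. (\<integral>\<^sup>+j. f (v + c + lattice_pt G j) \<partial>count_space UNIV) * indicator P v \<partial>lborel)
    = (\<integral>\<^sup>+x. f x \<partial>lborel)"
proof -
  have "(\<integral>\<^sup>+v. (\<integral>\<^sup>+j. f (v + c + lattice_pt G j) \<partial>count_space UNIV) * indicator P v \<partial>lborel)
      = (\<integral>\<^sup>+v. \<integral>\<^sup>+j. f (v + c + lattice_pt G j) * indicator P v \<partial>count_space UNIV \<partial>lborel)"
    by (intro nn_integral_cong) (simp add: nn_integral_multc)
  also have "\<dots> = (\<integral>\<^sup>+j. \<integral>\<^sup>+v. f (v + c + lattice_pt G j) * indicator P v \<partial>lborel \<partial>count_space UNIV)"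
    by (rule nn_integral_count_space_nn_integral) auto
  also have "\<dots> = (\<integral>\<^sup>+j. \<integral>\<^sup>+x. f x * indicator P (x - c + lattice_pt G (- j)) \<partial>lborel \<partial>count_space UNIV)"
  proof (rule nn_integral_cong)
    fix j
    show "(\<integral>\<^sup>+v. f (v + c + lattice_pt G j) * indicator P v \<partial>lborel) =
        (\<integral>\<^sup>+x. f x * indicator P (x - c + lattice_pt G (- j)) \<partial>lborel)"
      by (subst nn_integral_lborel_translate[where c="c + lattice_pt G j", symmetric])
         (auto simp: algebra_simps lattice_pt_minus)
  qed
  \<comment> \<open>Reindexing by \<open>- j\<close> brings the indicator into the form of
    \<open>sum_indicator_translates\<close>, which sums to 1 at every \<open>x\<close>.\<close>
  also have "\<dots> = (\<integral>\<^sup>+j. \<integral>\<^sup>+x. f x * indicator P (x - c + lattice_pt G j) \<partial>lborel \<partial>count_space UNIV)"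
    by (rule nn_integral_bij_count_space[where g=uminus]) (auto intro!: bij_uminus)
  also have "\<dots> = (\<integral>\<^sup>+x. \<integral>\<^sup>+j. f x * indicator P (x - c + lattice_pt G j) \<partial>count_space UNIV \<partial>lborel)"
    by (rule nn_integral_count_space_nn_integral[symmetric]) auto
  also have "\<dots> = (\<integral>\<^sup>+x. f x \<partial>lborel)"
    by (intro nn_integral_cong) (simp add: nn_integral_cmult sum_indicator_translates)
  finally show ?thesis .
qed

text \<open>The quantization error under dither \<open>v\<close>: the representative in
  \<open>P\<close> of \<open>v - x\<close> modulo the lattice.\<close>

definition err where "err x v = cell_quantizer G P (x - v) + v - x"

text \<open>Of the points \<open>v - x + lattice_pt G j\<close> exactly one lies in
  \<open>P\<close>, namely \<open>err x v\<close>. The integrand on the left is thus a periodization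
  of \<open>f\<close> restricted to \<open>P\<close>, and unfolding removes the dependence on
  \<open>x\<close>.\<close>

lemma err_lebesgue:
  fixes f :: "real^'n \<Rightarrow> ennreal"
  assumes [measurable]: "f \<in> borel_measurable borel"
  shows "(\<integral>\<^sup>+v. f (err x v) * indicator P v \<partial>lborel) = (\<integral>\<^sup>+z. f z * indicator P z \<partial>lborel)"
proof -
  have "f (err x v) = (\<integral>\<^sup>+j. f (v + - x + lattice_pt G j) * indicator P (v + - x + lattice_pt G j)
      \<partial>count_space UNIV)" for v
  proof -
    obtain k where k: "cell_quantizer G P (x - v) = lattice_pt G k" "lattice_pt G k - (x - v) \<in> P"
      by (rule cell_quantizer_cases)
    then have k': "v + - x + lattice_pt G k \<in> P" by (simp add: algebra_simps)
    then have "f (v + - x + lattice_pt G j) * indicator P (v + - x + lattice_pt G j)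
        = f (err x v) * indicator {k} j" for j
      using ex1_translate[of "v + - x"] k
      by (cases "j = k") (auto simp: indicator_def err_def algebra_simps)
    then show ?thesis by simp
  qed
  then show ?thesis
    using unfolding_integral[of "\<lambda>z. f z * indicator P z" "- x"] by simp
qed

abbreviation U where "U \<equiv> uniform_measure lborel P"

lemma prob_space_U: "prob_space U"
  using P_pos P_finite by (intro prob_space_uniform_measure) auto

lemma err_law:
  fixes f :: "real^'n \<Rightarrow> ennreal"
  assumes [measurable]: "f \<in> borel_measurable borel"
  shows "(\<integral>\<^sup>+v. f (err x v) \<partial>U) = (\<integral>\<^sup>+z. f z \<partial>U)"
proof -
  have [measurable]: "(\<lambda>v. err x v) \<in> borel_measurable borel"
    unfolding err_def by measurable
  show ?thesis
    by (simp add: nn_integral_uniform_measure err_lebesgue)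
qed

lemma unfolding_integral_U:
  fixes f :: "real^'n \<Rightarrow> ennreal"
  assumes [measurable]: "f \<in> borel_measurable borel"
  shows "(\<integral>\<^sup>+v. (\<integral>\<^sup>+j. f (v + c + lattice_pt G j) \<partial>count_space UNIV) \<partial>U)
    = (\<integral>\<^sup>+x. f x \<partial>lborel) / emeasure lborel P"
  by (subst nn_integral_uniform_measure)
     (auto simp: unfolding_integral intro!: borel_measurable_nn_integral_count_space)

section \<open>The shared state and the first accepted candidate\<close>

definition accept_prob :: real where "accept_prob = measure lborel A / measure lborel P"

abbreviation L where "L \<equiv> rsuq_state P"

lemma emeasure_P_eq: "emeasure lborel P = ennreal (measure lborel P)"
  using P_finite by (intro emeasure_eq_ennreal_measure) auto

lemma emeasure_A_eq: "emeasure lborel A = ennreal (measure lborel A)"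
  using A_finite by (intro emeasure_eq_ennreal_measure) auto

lemma measure_P_pos: "measure lborel P > 0"
  using P_pos by (simp add: emeasure_P_eq)

lemma measure_A_pos: "measure lborel A > 0"
  using A_pos by (simp add: emeasure_A_eq)

lemma accept_prob_pos: "0 < accept_prob"
  using measure_P_pos measure_A_pos by (simp add: accept_prob_def)

lemma accept_prob_le_1: "accept_prob \<le> 1"
proof -
  have "measure lborel A \<le> measure lborel P"
    using emeasure_mono[OF A_sub, of lborel] by (simp add: emeasure_P_eq emeasure_A_eq)
  then show ?thesis
    using measure_P_pos by (simp add: accept_prob_def)
qed

lemma emeasure_U_A: "emeasure U A = ennreal accept_prob"
proof -
  have "P \<inter> A = A" using A_sub by auto
  then have "emeasure U A = emeasure lborel A / emeasure lborel P"
    by simp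
  then show ?thesis
    using measure_P_pos by (simp add: emeasure_P_eq emeasure_A_eq divide_ennreal accept_prob_def)
qed

lemma emeasure_U_not_A: "emeasure U (- A) = ennreal (1 - accept_prob)"
proof -
  interpret prob_space U by (rule prob_space_U)
  have "measure U A = accept_prob"
    using emeasure_U_A accept_prob_pos by (simp add: measure_def)
  moreover have "measure U (space U - A) = 1 - measure U A"
    by (intro prob_compl) auto
  ultimately show ?thesis
    by (simp add: emeasure_eq_measure Compl_eq_Diff_UNIV)
qed

lemma sets_L[measurable_cong]: "sets L = sets state_space"
  unfolding rsuq_state_def by (intro sets_PiM_cong) auto

lemma space_L[simp]: "space L = UNIV"
  unfolding rsuq_state_def by (simp add: space_PiM PiE_UNIV_domain)

lemma prob_space_L: "prob_space L"
  unfolding rsuq_state_def by (intro prob_space_PiM prob_space_U)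

lemma distr_L_component: "distr L U (\<lambda>s. s i) = U"
  unfolding rsuq_state_def by (intro distr_PiM_component prob_space_U) auto

lemma measurable_err_state[measurable]:
  "(\<lambda>z. err (fst z) (snd z k)) \<in> borel_measurable (borel \<Otimes>\<^sub>M state_space)"
  unfolding err_def by measurable

definition accept_index :: "real^'n \<Rightarrow> (nat \<Rightarrow> real^'n) \<Rightarrow> nat" where "accept_index x s = (LEAST i. err x (s i) \<in> A)"

lemma measurable_accept_index[measurable]:
  "(\<lambda>z. accept_index (fst z) (snd z)) \<in> measurable (borel \<Otimes>\<^sub>M state_space) (count_space UNIV)"
  unfolding accept_index_def by measurable

lemma rsuq_eq: "rsuq G P A x s = x + err x (s (accept_index x s))"
  by (simp add: rsuq_def accept_index_def err_def Let_def)

lemma measurable_rsuq[measurable]: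
  "(\<lambda>z. rsuq G P A (fst z) (snd z)) \<in> borel_measurable (borel \<Otimes>\<^sub>M state_space)"
proof -
  have "(\<lambda>z. err (fst z) (snd z (accept_index (fst z) (snd z)))) \<in> borel_measurable (borel \<Otimes>\<^sub>M state_space)"
    by (rule measurable_compose_countable[where f="\<lambda>i z. err (fst z) (snd z i)"]) measurable
  then show ?thesis
    unfolding rsuq_eq by measurable
qed

lemmas measurable_rsuq'[measurable (raw)] =
  measurable_compose[OF measurable_Pair measurable_rsuq, simplified]

lemmas measurable_accept_index'[measurable (raw)] =
  measurable_compose[OF measurable_Pair measurable_accept_index, simplified]

lemma measurable_const_state[measurable]: "(\<lambda>_. s) \<in> measurable N state_space"
  by (intro measurable_const) (simp add: space_PiM PiE_UNIV_domain)

text \<open>Given the state, the output ranges over the countable union of the grids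
  \<open>s k + lattice_pt G j\<close>; this makes its conditional law discrete.\<close>

lemma rsuq_grid: "\<exists>j. rsuq G P A x s = s (accept_index x s) + lattice_pt G j"
proof -
  obtain j where "cell_quantizer G P (x - s (accept_index x s)) = lattice_pt G j"
    by (rule cell_quantizer_cases)
  then show ?thesis
    by (auto simp: rsuq_eq err_def algebra_simps)
qed

text \<open>\<open>LEAST\<close> yields an unspecified index when no candidate is accepted. This
  predicate is then false for every \<open>k\<close>, so its events have exact geometric
  probabilities.\<close>

definition first_accept :: "real^'n \<Rightarrow> nat \<Rightarrow> (nat \<Rightarrow> real^'n) \<Rightarrow> bool" where
  "first_accept x k s \<longleftrightarrow> (\<forall>i<k. err x (s i) \<notin> A) \<and> err x (s k) \<in> A"

lemma first_accept_imp_index: "first_accept x k s \<Longrightarrow> accept_index x s = k"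
  unfolding accept_index_def first_accept_def
  by (rule Least_equality) (auto simp: not_less[symmetric])

lemma first_accept_unique: "first_accept x k s \<Longrightarrow> first_accept x i s \<longleftrightarrow> i = k"
  using first_accept_imp_index by blast

lemma measurable_err1[measurable]: "(\<lambda>v. err x v) \<in> borel_measurable borel"
  unfolding err_def by measurable

lemma measurable_first_accept[measurable]: "Measurable.pred state_space (first_accept x k)"
  unfolding first_accept_def by measurable

text \<open>An i.i.d. sequence is its first entry followed by an independent copy of the sequence;
  this drives the induction on the number of rejections.\<close>

lemma nn_integral_L_unfold:
  assumes [measurable]: "F \<in> borel_measurable state_space"
  shows "(\<integral>\<^sup>+s. F s \<partial>L) = (\<integral>\<^sup>+v. \<integral>\<^sup>+s. F (case_nat v s) \<partial>L \<partial>U)"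
proof -
  interpret U: prob_space U by (rule prob_space_U)
  interpret L: prob_space L by (rule prob_space_L)
  interpret sequence_space U ..
  have [measurable]: "(\<lambda>(v, s). case_nat v s) \<in> measurable (U \<Otimes>\<^sub>M L) L"
    unfolding rsuq_state_def by measurable
  have F[measurable]: "F \<in> borel_measurable L" by measurable
  have "(\<integral>\<^sup>+s. F s \<partial>L) = (\<integral>\<^sup>+s. F s \<partial>distr (U \<Otimes>\<^sub>M L) L (\<lambda>(v, s). case_nat v s))"
    using PiM_iter by (simp add: rsuq_state_def)
  also have "\<dots> = (\<integral>\<^sup>+z. F (case z of (v, s) \<Rightarrow> case_nat v s) \<partial>(U \<Otimes>\<^sub>M L))"
    by (rule nn_integral_distr) measurable
  also have "\<dots> = (\<integral>\<^sup>+v. \<integral>\<^sup>+s. F (case_nat v s) \<partial>L \<partial>U)"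
    by (subst L.nn_integral_fst[symmetric]) auto
  finally show ?thesis .
qed

text \<open>Condition on the first candidate: it is rejected with probability
  \<open>1 - accept_prob\<close>, after which the search starts afresh. The accepted error keeps the
  law of \<open>U\<close> restricted to \<open>A\<close> at every stage.\<close>

lemma nn_integral_first_accept:
  fixes h :: "real^'n \<Rightarrow> ennreal"
  assumes [measurable]: "h \<in> borel_measurable borel"
  shows "(\<integral>\<^sup>+s. h (err x (s k)) * indicator {s. first_accept x k s} s \<partial>L)
    = ennreal (1 - accept_prob) ^ k * (\<integral>\<^sup>+z. h z * indicator A z \<partial>U)"
proof (induction k)
  case 0
  interpret L: prob_space L by (rule prob_space_L)
  have "(\<integral>\<^sup>+s. h (err x (s 0)) * indicator {s. first_accept x 0 s} s \<partial>L)
      = (\<integral>\<^sup>+v. \<integral>\<^sup>+s. h (err x v) * indicator A (err x v) \<partial>L \<partial>U)"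
    by (subst nn_integral_L_unfold) (auto intro!: nn_integral_cong simp: first_accept_def indicator_def)
  also have "\<dots> = (\<integral>\<^sup>+v. h (err x v) * indicator A (err x v) \<partial>U)"
    using L.emeasure_space_1 by simp
  also have "\<dots> = (\<integral>\<^sup>+z. h z * indicator A z \<partial>U)"
    by (rule err_law) measurable
  finally show ?case by simp
next
  case (Suc k)
  let ?I = "\<integral>\<^sup>+z. h z * indicator A z \<partial>U"
  have "(\<integral>\<^sup>+s. h (err x (s (Suc k))) * indicator {s. first_accept x (Suc k) s} s \<partial>L)
      = (\<integral>\<^sup>+v. \<integral>\<^sup>+s. indicator (- A) (err x v) *
           (h (err x (s k)) * indicator {s. first_accept x k s} s) \<partial>L \<partial>U)"
    by (subst nn_integral_L_unfold)
       (auto intro!: nn_integral_cong simp: first_accept_def indicator_def All_less_Suc2)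
  also have "\<dots> = (\<integral>\<^sup>+v. indicator (- A) (err x v) * (ennreal (1 - accept_prob) ^ k * ?I) \<partial>U)"
    by (intro nn_integral_cong) (simp add: nn_integral_cmult Suc.IH)
  also have "\<dots> = (\<integral>\<^sup>+v. indicator (- A) (err x v) \<partial>U) * (ennreal (1 - accept_prob) ^ k * ?I)"
    by (intro nn_integral_multc) measurable
  also have "(\<integral>\<^sup>+v. indicator (- A) (err x v) \<partial>U) = (\<integral>\<^sup>+z. indicator (- A) z \<partial>U)"
    by (rule err_law) measurable
  also have "\<dots> = ennreal (1 - accept_prob)"
    using emeasure_U_not_A by simp
  finally show ?case by (simp add: mult.assoc)
qed

lemma geometric_ennreal:
  "(\<integral>\<^sup>+k. ennreal (1 - accept_prob) ^ k \<partial>count_space UNIV) = ennreal (1 / accept_prob)"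
proof -
  have "(\<lambda>k. (1 - accept_prob) ^ k) sums (1 / (1 - (1 - accept_prob)))"
    using accept_prob_pos accept_prob_le_1 by (intro geometric_sums) auto
  then have "(\<Sum>k. ennreal ((1 - accept_prob) ^ k)) = ennreal (1 / accept_prob)"
    using accept_prob_le_1 by (intro suminf_ennreal_eq) auto
  then show ?thesis
    using accept_prob_le_1 by (simp add: nn_integral_count_space_nat ennreal_power)
qed

text \<open>The acceptance events are disjoint, and their geometric probabilities sum to 1.\<close>

lemma AE_first_accept: "AE s in L. \<exists>k. first_accept x k s"
proof -
  interpret L: prob_space L by (rule prob_space_L)
  have ind: "(\<integral>\<^sup>+k. indicator {s. first_accept x k s} s \<partial>count_space UNIV)
      = (indicator {s. \<exists>k. first_accept x k s} s :: ennreal)" for s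
  proof (cases "\<exists>k. first_accept x k s")
    case True
    then obtain k where "first_accept x k s" by blast
    then have "first_accept x i s \<longleftrightarrow> i = k" for i
      by (rule first_accept_unique)
    then have "(indicator {s. first_accept x i s} s :: ennreal) = indicator {k} i" for i
      by (simp add: indicator_def)
    with True show ?thesis by simp
  qed simp
  have "{s \<in> space state_space. \<exists>k. first_accept x k s} \<in> sets state_space"
    by measurable
  then have [measurable]: "{s. \<exists>k. first_accept x k s} \<in> sets state_space"
    by (simp add: space_PiM PiE_UNIV_domain)
  have "emeasure L {s. \<exists>k. first_accept x k s} = (\<integral>\<^sup>+s. indicator {s. \<exists>k. first_accept x k s} s \<partial>L)"
    by (intro nn_integral_indicator[symmetric]) measurable
  also have "\<dots> = (\<integral>\<^sup>+s. \<integral>\<^sup>+k. indicator {s. first_accept x k s} s \<partial>count_space UNIV \<partial>L)"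
    by (simp add: ind)
  also have "\<dots> = (\<integral>\<^sup>+k. \<integral>\<^sup>+s. indicator {s. first_accept x k s} s \<partial>L \<partial>count_space UNIV)"
    by (intro nn_integral_count_space_nn_integral) auto
  also have "\<dots> = (\<integral>\<^sup>+k. ennreal (1 - accept_prob) ^ k * ennreal accept_prob \<partial>count_space UNIV)"
    using nn_integral_first_accept[of "\<lambda>_. 1" x] emeasure_U_A by simp
  also have "\<dots> = ennreal (1 / accept_prob) * ennreal accept_prob"
    by (simp add: nn_integral_multc geometric_ennreal)
  also have "\<dots> = 1"
    using accept_prob_pos by (simp add: ennreal_mult[symmetric])
  finally show ?thesis
    by (subst L.AE_iff_emeasure_eq_1) simp_all
qed

text \<open>Almost surely exactly one event \<open>first_accept x k\<close> holds. Splitting along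
  it factorizes the joint law: the index is geometric and the error is independent of it.\<close>

lemma nn_integral_rsuq:
  fixes \<phi> :: "nat \<Rightarrow> real^'n \<Rightarrow> ennreal"
  assumes [measurable]: "\<And>k. \<phi> k \<in> borel_measurable borel"
  shows "(\<integral>\<^sup>+s. \<phi> (accept_index x s) (rsuq G P A x s) \<partial>L)
    = (\<integral>\<^sup>+k. ennreal (1 - accept_prob) ^ k * (\<integral>\<^sup>+z. \<phi> k (x + z) * indicator A z \<partial>U) \<partial>count_space UNIV)"
proof -
  have "(\<integral>\<^sup>+s. \<phi> (accept_index x s) (rsuq G P A x s) \<partial>L) =
      (\<integral>\<^sup>+s. \<integral>\<^sup>+k. \<phi> k (x + err x (s k)) * indicator {s. first_accept x k s} s \<partial>count_space UNIV \<partial>L)"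
    using AE_first_accept
  proof (rule nn_integral_cong_AE[OF AE_mp], intro AE_I2 impI)
    fix s assume "\<exists>k. first_accept x k s"
    then obtain k where k: "first_accept x k s" by blast
    then have "first_accept x i s \<longleftrightarrow> i = k" for i
      by (rule first_accept_unique)
    then have "\<phi> i (x + err x (s i)) * indicator {s. first_accept x i s} s
        = \<phi> k (x + err x (s k)) * indicator {k} i" for i
      by (simp add: indicator_def)
    then show "\<phi> (accept_index x s) (rsuq G P A x s) =
        (\<integral>\<^sup>+k. \<phi> k (x + err x (s k)) * indicator {s. first_accept x k s} s \<partial>count_space UNIV)"
      using first_accept_imp_index[OF k] by (simp add: rsuq_eq)
  qed
  also have "\<dots> = (\<integral>\<^sup>+k. \<integral>\<^sup>+s. \<phi> k (x + err x (s k)) * indicator {s. first_accept x k s} s \<partial>L \<partial>count_space UNIV)"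
    by (intro nn_integral_count_space_nn_integral) auto
  also have "\<dots> = (\<integral>\<^sup>+k. ennreal (1 - accept_prob) ^ k *
      (\<integral>\<^sup>+z. \<phi> k (x + z) * indicator A z \<partial>U) \<partial>count_space UNIV)"
    by (intro nn_integral_cong nn_integral_first_accept) measurable
  finally show ?thesis .
qed

section \<open>Law of the accepted error and mean of the accepted index\<close>

abbreviation Z where "Z \<equiv> uniform_measure lborel A"

lemma prob_space_Z: "prob_space Z"
  using A_pos A_finite by (intro prob_space_uniform_measure) auto

text \<open>Rejection sampling: the geometric series contributes \<open>1 / accept_prob\<close>,
  which renormalizes the restriction of \<open>U\<close> to \<open>A\<close> into the uniform law on
  \<open>A\<close>.\<close>

lemma rsuq_law:
  fixes h :: "real^'n \<Rightarrow> ennreal"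
  assumes [measurable]: "h \<in> borel_measurable borel"
  shows "(\<integral>\<^sup>+s. h (rsuq G P A x s) \<partial>L) = (\<integral>\<^sup>+z. h (x + z) \<partial>Z)"
proof -
  let ?I = "\<integral>\<^sup>+z. h (x + z) * indicator A z \<partial>lborel"
  have "(\<integral>\<^sup>+z. h (x + z) * indicator A z \<partial>U) = (\<integral>\<^sup>+z. h (x + z) * indicator A z * indicator P z \<partial>lborel) / emeasure lborel P"
    by (subst nn_integral_uniform_measure) auto
  also have "(\<integral>\<^sup>+z. h (x + z) * indicator A z * indicator P z \<partial>lborel) = ?I"
    using A_sub by (intro nn_integral_cong) (auto simp: indicator_def)
  finally have "(\<integral>\<^sup>+s. h (rsuq G P A x s) \<partial>L) = ennreal (1 / accept_prob) * (?I / emeasure lborel P)"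
    using nn_integral_rsuq[of "\<lambda>_. h" x] by (simp add: nn_integral_multc geometric_ennreal)
  also have "\<dots> = ?I * (ennreal (1 / accept_prob) * ennreal (1 / measure lborel P))"
    using measure_P_pos
    by (simp add: emeasure_P_eq divide_ennreal_def inverse_ennreal inverse_eq_divide mult_ac)
  also have "ennreal (1 / accept_prob) * ennreal (1 / measure lborel P) = ennreal (1 / measure lborel A)"
    using accept_prob_pos measure_P_pos measure_A_pos
    by (subst ennreal_mult[symmetric]) (auto simp: accept_prob_def)
  also have "?I * \<dots> = (\<integral>\<^sup>+z. h (x + z) \<partial>Z)"
    using measure_A_pos
    by (subst nn_integral_uniform_measure)
       (auto simp: emeasure_A_eq divide_ennreal_def inverse_ennreal inverse_eq_divide mult_ac)
  finally show ?thesis .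
qed

text \<open>Indices start at 0, so this is the mean number of rejections, one less than the mean
  number \<open>1 / accept_prob\<close> of candidates.\<close>

lemma nn_integral_accept_index:
  "(\<integral>\<^sup>+s. ennreal (real (accept_index x s)) \<partial>L) = ennreal ((1 - accept_prob) / accept_prob)"
proof -
  let ?r = "1 - accept_prob"
  have r: "\<bar>?r\<bar> < 1" "0 \<le> ?r"
    using accept_prob_pos accept_prob_le_1 by auto
  \<comment> \<open>\<open>n * r ^ n\<close> is obtained as \<open>(n + 1) * r ^ n - r ^ n\<close>,
    the difference of the derivative series and the geometric series.\<close>
  have "(\<lambda>n. real (Suc n) * ?r ^ n - ?r ^ n) sums (1 / (1 - ?r)^2 - 1 / (1 - ?r))"
    using r by (intro sums_diff geometric_deriv_sums geometric_sums) auto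
  then have "(\<lambda>n. (real (Suc n) * ?r ^ n - ?r ^ n) * accept_prob) sums
      ((1 / (1 - ?r)^2 - 1 / (1 - ?r)) * accept_prob)"
    by (rule sums_mult2)
  also have "(\<lambda>n. (real (Suc n) * ?r ^ n - ?r ^ n) * accept_prob) = (\<lambda>n. ?r ^ n * real n * accept_prob)"
    by (auto simp: algebra_simps)
  also have "(1 / (1 - ?r)^2 - 1 / (1 - ?r)) * accept_prob = ?r / accept_prob"
    using accept_prob_pos by (simp add: field_simps power2_eq_square)
  finally have "(\<Sum>n. ennreal (?r ^ n * real n * accept_prob)) = ennreal (?r / accept_prob)"
    using r accept_prob_pos by (intro suminf_ennreal_eq) auto
  moreover have "(\<integral>\<^sup>+s. ennreal (real (accept_index x s)) \<partial>L) =
      (\<Sum>n. ennreal (?r ^ n * real n * accept_prob))"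
    using nn_integral_rsuq[of "\<lambda>k _. ennreal (real k)" x] r accept_prob_pos
    by (simp add: nn_integral_count_space_nat nn_integral_cmult emeasure_U_A ennreal_mult ennreal_power mult_ac)
  ultimately show ?thesis by simp
qed

section \<open>Uniform noise\<close>

text \<open>The density of \<open>T + Z\<close> for \<open>T\<close> of law \<open>N\<close>: the
  convolution of \<open>N\<close> with the uniform density on \<open>A\<close>. This version is a
  real number at every point, so \<open>noise_density_le\<close> holds everywhere and not only
  almost everywhere.\<close>

definition noise_density :: "(real^'n) measure \<Rightarrow> real^'n \<Rightarrow> real" where
  "noise_density N y = measure N {t. y - t \<in> A} / measure lborel A"

lemma noise_density_nonneg: "0 \<le> noise_density N y"
  by (simp add: noise_density_def)

lemma measurable_noise_density[measurable]:
  assumes N: "prob_space N" and sN[measurable_cong]: "sets N = sets borel"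
  shows "noise_density N \<in> borel_measurable borel"
proof -
  interpret prob_space N by fact
  have "{z \<in> space (borel \<Otimes>\<^sub>M N). fst z - snd z \<in> A} \<in> sets (borel \<Otimes>\<^sub>M N)"
    by measurable
  from measurable_emeasure_Pair[OF this]
  have "(\<lambda>y. emeasure N (Pair y -` {z. fst z - snd z \<in> A})) \<in> borel_measurable borel"
    using sets_eq_imp_space_eq[OF sN] by (simp add: space_pair_measure)
  then have [measurable]: "(\<lambda>y. measure N {t. y - t \<in> A}) \<in> borel_measurable borel"
    by (simp add: vimage_def measure_def)
  show ?thesis
    unfolding noise_density_def by measurable
qed

text \<open>The density is a probability divided by \<mu>(A). Hence minus the logarithm of the left
  side is nonnegative, and its mean can be taken in \<open>ennreal\<close>.\<close>

lemma noise_density_le: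
  assumes "prob_space N"
  shows "measure lborel A * noise_density N y \<le> 1"
  using prob_space.prob_le_1[OF assms] measure_A_pos by (simp add: noise_density_def)

lemma nn_integral_Z:
  assumes [measurable]: "h \<in> borel_measurable borel"
  shows "(\<integral>\<^sup>+z. h z \<partial>Z) = (\<integral>\<^sup>+z. h z * ennreal (indicator A z / measure lborel A) \<partial>lborel)"
proof -
  have "(\<integral>\<^sup>+z. h z \<partial>Z) = (\<integral>\<^sup>+z. h z * indicator A z \<partial>lborel) * ennreal (1 / measure lborel A)"
    using measure_A_pos
    by (simp add: nn_integral_uniform_measure emeasure_A_eq divide_ennreal_def inverse_ennreal inverse_eq_divide)
  also have "\<dots> = (\<integral>\<^sup>+z. h z * indicator A z * ennreal (1 / measure lborel A) \<partial>lborel)"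
    by (intro nn_integral_multc[symmetric]) auto
  also have "\<dots> = (\<integral>\<^sup>+z. h z * ennreal (indicator A z / measure lborel A) \<partial>lborel)"
    by (intro nn_integral_cong) (auto simp: indicator_def)
  finally show ?thesis .
qed

text \<open>Given \<open>T = t\<close>, the sum \<open>T + Z\<close> has density
  \<open>indicator A (y - t) / measure lborel A\<close> in \<open>y\<close>; Tonelli then moves
  \<open>y\<close> to the outer integral.\<close>

lemma nn_integral_noisy:
  assumes N: "prob_space N" and sN[measurable_cong]: "sets N = sets borel"
    and [measurable]: "h \<in> borel_measurable (borel \<Otimes>\<^sub>M borel)"
  shows "(\<integral>\<^sup>+t. \<integral>\<^sup>+z. h (t, t + z) \<partial>Z \<partial>N) =
    (\<integral>\<^sup>+y. \<integral>\<^sup>+t. h (t, y) * ennreal (indicator A (y - t) / measure lborel A) \<partial>N \<partial>lborel)"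
proof -
  interpret N: prob_space N by fact
  interpret pair_sigma_finite N lborel ..
  have "(\<integral>\<^sup>+t. \<integral>\<^sup>+z. h (t, t + z) \<partial>Z \<partial>N) =
      (\<integral>\<^sup>+t. \<integral>\<^sup>+y. h (t, y) * ennreal (indicator A (y - t) / measure lborel A) \<partial>lborel \<partial>N)"
  proof (rule nn_integral_cong)
    fix t
    have "(\<integral>\<^sup>+z. h (t, t + z) \<partial>Z) =
        (\<integral>\<^sup>+z. h (t, t + z) * ennreal (indicator A (t + z - t) / measure lborel A) \<partial>lborel)"
      by (simp add: nn_integral_Z)
    also have "\<dots> = (\<integral>\<^sup>+y. h (t, y) * ennreal (indicator A (y - t) / measure lborel A) \<partial>lborel)"
      by (rule nn_integral_lborel_translate[where f="\<lambda>y. h (t, y) * ennreal (indicator A (y - t) / measure lborel A)"])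
         measurable
    finally show "(\<integral>\<^sup>+z. h (t, t + z) \<partial>Z) = \<dots>" .
  qed
  also have "\<dots> = (\<integral>\<^sup>+y. \<integral>\<^sup>+t. h (t, y) * ennreal (indicator A (y - t) / measure lborel A) \<partial>N \<partial>lborel)"
    by (rule Fubini'[symmetric]) measurable
  finally show ?thesis .
qed

lemma noise_density_eq_integral:
  assumes N: "prob_space N" and sN[measurable_cong]: "sets N = sets borel"
  shows "(\<integral>\<^sup>+t. ennreal (indicator A (y - t) / measure lborel A) \<partial>N) = ennreal (noise_density N y)"
proof -
  interpret N: prob_space N by fact
  have sp: "space N = UNIV" using sets_eq_imp_space_eq[OF sN] by simp
  have "{t \<in> space N. y - t \<in> A} \<in> sets N" by measurable
  then have [measurable]: "{t. y - t \<in> A} \<in> sets N" by (simp add: sp)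
  have "(\<integral>\<^sup>+t. ennreal (indicator A (y - t) / measure lborel A) \<partial>N)
      = (\<integral>\<^sup>+t. ennreal (1 / measure lborel A) * indicator {t. y - t \<in> A} t \<partial>N)"
    by (intro nn_integral_cong) (auto simp: indicator_def)
  also have "\<dots> = ennreal (1 / measure lborel A) * emeasure N {t. y - t \<in> A}"
    by (intro nn_integral_cmult_indicator) auto
  also have "\<dots> = ennreal (noise_density N y)"
    by (simp add: N.emeasure_eq_measure noise_density_def ennreal_mult[symmetric])
  finally show ?thesis .
qed

lemma nn_integral_noisy_sum:
  assumes N: "prob_space N" and sN[measurable_cong]: "sets N = sets borel"
    and [measurable]: "h \<in> borel_measurable borel"
  shows "(\<integral>\<^sup>+t. \<integral>\<^sup>+z. h (t + z) \<partial>Z \<partial>N) = (\<integral>\<^sup>+y. h y * ennreal (noise_density N y) \<partial>lborel)"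
  using nn_integral_noisy[OF N sN, of "\<lambda>z. h (snd z)"]
  by (simp add: nn_integral_cmult noise_density_eq_integral[OF N sN])

lemma nn_integral_noise_density:
  assumes N: "prob_space N" and sN: "sets N = sets borel"
  shows "(\<integral>\<^sup>+y. ennreal (noise_density N y) \<partial>lborel) = 1"
  using nn_integral_noisy_sum[OF N sN, of "\<lambda>_. 1"] prob_space.emeasure_space_1[OF prob_space_Z]
    prob_space.emeasure_space_1[OF N] by simp

text \<open>Given \<open>T = t\<close>, the sum \<open>T + Z\<close> has density \<open>1 / \<mu>(A)\<close> on \<open>t + A\<close>, so the information density
  is \<open>- log (\<mu>(A) f(T + Z))\<close> where \<open>f\<close> is the density of \<open>T + Z\<close>.\<close>

lemma mutual_info_noise_ge:
  assumes N: "prob_space N" and sN[measurable_cong]: "sets N = sets borel"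
  shows "enn2ereal (\<integral>\<^sup>+t. \<integral>\<^sup>+z. ennreal (- log 2 (measure lborel A * noise_density N (t + z))) \<partial>Z \<partial>N)
    \<le> mutual_info (N \<Otimes>\<^sub>M Z) borel borel fst (\<lambda>(t, z). t + z)"
proof -
  interpret N: prob_space N by fact
  interpret Z: prob_space Z by (rule prob_space_Z)
  interpret NZ: pair_prob_space N Z ..
  let ?a = "measure lborel A"
  let ?f = "noise_density N"
  note [measurable] = measurable_noise_density[OF N sN]
  define Y where "Y = density lborel (\<lambda>y. ennreal (?f y))"
  define J where "J = distr (N \<Otimes>\<^sub>M Z) (borel \<Otimes>\<^sub>M borel) (\<lambda>\<omega>. (fst \<omega>, (case \<omega> of (t, z) \<Rightarrow> t + z)))"
  \<comment> \<open>Candidate density of \<open>(T, T + Z)\<close> with respect to the product of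
    its marginals: conditional density over marginal density. Division by zero gives 0 where
    \<open>?f\<close> vanishes.\<close>
  define h where "h = (\<lambda>w. ennreal (indicator A (snd w - fst w) / (?a * ?f (snd w))))"
  have sY[measurable_cong, simp]: "sets Y = sets borel" by (simp add: Y_def)
  have sJ[measurable_cong, simp]: "sets J = sets (borel \<Otimes>\<^sub>M borel)" by (simp add: J_def)
  have [measurable]: "h \<in> borel_measurable (borel \<Otimes>\<^sub>M borel)" unfolding h_def by measurable
  have dY: "distr (N \<Otimes>\<^sub>M Z) borel (\<lambda>(t, z). t + z) = Y"
  proof (rule measure_eqI)
    fix B assume "B \<in> sets (distr (N \<Otimes>\<^sub>M Z) borel (\<lambda>(t, z). t + z))"
    then have [measurable]: "B \<in> sets borel" by simp
    have "emeasure (distr (N \<Otimes>\<^sub>M Z) borel (\<lambda>(t, z). t + z)) B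
        = (\<integral>\<^sup>+y. indicator B y \<partial>distr (N \<Otimes>\<^sub>M Z) borel (\<lambda>(t, z). t + z))" by simp
    also have "\<dots> = (\<integral>\<^sup>+w. indicator B (fst w + snd w) \<partial>(N \<Otimes>\<^sub>M Z))"
      by (subst nn_integral_distr) (auto simp: case_prod_beta')
    also have "\<dots> = (\<integral>\<^sup>+t. \<integral>\<^sup>+z. indicator B (t + z) \<partial>Z \<partial>N)"
      by (subst Z.nn_integral_fst[symmetric]) auto
    also have "\<dots> = emeasure Y B"
      by (subst nn_integral_noisy_sum[OF N sN]) (auto simp: Y_def emeasure_density mult.commute)
    finally show "emeasure (distr (N \<Otimes>\<^sub>M Z) borel (\<lambda>(t, z). t + z)) B = emeasure Y B" .
  qed simp
  interpret Y: prob_space Y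
    unfolding dY[symmetric] by (intro NZ.prob_space_distr) measurable
  interpret NY: pair_prob_space N Y ..
  have dN: "distr (N \<Otimes>\<^sub>M Z) borel fst = N"
    using Z.distr_pair_fst[of N] sN by (simp cong: distr_cong)
  have nnJ: "(\<integral>\<^sup>+w. k w \<partial>J) = (\<integral>\<^sup>+t. \<integral>\<^sup>+z. k (t, t + z) \<partial>Z \<partial>N)"
    if [measurable]: "k \<in> borel_measurable (borel \<Otimes>\<^sub>M borel)" for k :: "_ \<Rightarrow> ennreal"
    unfolding J_def by (subst nn_integral_distr) (auto simp: Z.nn_integral_fst[symmetric])
  have Jd: "density (N \<Otimes>\<^sub>M Y) h = J"
  proof (rule measure_eqI)
    fix B assume "B \<in> sets (density (N \<Otimes>\<^sub>M Y) h)"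
    then have [measurable]: "B \<in> sets (borel \<Otimes>\<^sub>M borel)"
      using sets_pair_measure_cong[OF sN sY] by simp
    have "emeasure (density (N \<Otimes>\<^sub>M Y) h) B = (\<integral>\<^sup>+w. h w * indicator B w \<partial>(N \<Otimes>\<^sub>M Y))"
      by (intro emeasure_density) measurable
    also have "\<dots> = (\<integral>\<^sup>+y. \<integral>\<^sup>+t. h (t, y) * indicator B (t, y) \<partial>N \<partial>Y)"
      by (intro NY.nn_integral_snd[symmetric]) measurable
    also have "\<dots> = (\<integral>\<^sup>+y. ennreal (?f y) * (\<integral>\<^sup>+t. h (t, y) * indicator B (t, y) \<partial>N) \<partial>lborel)"
      unfolding Y_def by (intro nn_integral_density) measurable
    also have "\<dots> = (\<integral>\<^sup>+y. \<integral>\<^sup>+t. indicator B (t, y) * ennreal (indicator A (y - t) / ?a) \<partial>N \<partial>lborel)"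
    proof (rule nn_integral_cong)
      fix y
      show "ennreal (?f y) * (\<integral>\<^sup>+t. h (t, y) * indicator B (t, y) \<partial>N)
          = (\<integral>\<^sup>+t. indicator B (t, y) * ennreal (indicator A (y - t) / ?a) \<partial>N)"
      proof (cases "?f y = 0")
        \<comment> \<open>At a zero of \<open>?f\<close> the right side is 0 too, being at most the
          integral whose value is \<open>?f y\<close>.\<close>
        case True
        then have "(\<integral>\<^sup>+t. ennreal (indicator A (y - t) / ?a) \<partial>N) = 0"
          by (simp add: noise_density_eq_integral[OF N sN])
        moreover have "(\<integral>\<^sup>+t. indicator B (t, y) * ennreal (indicator A (y - t) / ?a) \<partial>N) \<le>
            (\<integral>\<^sup>+t. ennreal (indicator A (y - t) / ?a) \<partial>N)"
          by (intro nn_integral_mono) (auto simp: indicator_def)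
        ultimately show ?thesis using True by simp
      next
        case False
        then have "?f y > 0" using noise_density_nonneg[of N y] by simp
        then have "ennreal (?f y) * (h (t, y) * indicator B (t, y))
            = indicator B (t, y) * ennreal (indicator A (y - t) / ?a)" for t
          by (auto simp: h_def indicator_def ennreal_mult[symmetric])
        then show ?thesis
          by (subst nn_integral_cmult[symmetric]) auto
      qed
    qed
    also have "\<dots> = (\<integral>\<^sup>+t. \<integral>\<^sup>+z. indicator B (t, t + z) \<partial>Z \<partial>N)"
      by (intro nn_integral_noisy[OF N sN, symmetric]) measurable
    also have "\<dots> = (\<integral>\<^sup>+w. indicator B w \<partial>J)"
      by (intro nnJ[symmetric]) measurable
    also have "\<dots> = emeasure J B" by simp
    finally show "emeasure (density (N \<Otimes>\<^sub>M Y) h) B = emeasure J B" .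
  qed (use sets_pair_measure_cong[OF sN sY] in simp)
  have "AE w in N \<Otimes>\<^sub>M Y. h w = RN_deriv (N \<Otimes>\<^sub>M Y) J w"
    by (intro NY.RN_deriv_unique Jd) measurable
  \<comment> \<open>A density is positive almost everywhere for the measure it defines; this
    discards the points where the indicator or \<open>?f\<close> vanishes.\<close>
  then have "AE w in density (N \<Otimes>\<^sub>M Y) h. h w = RN_deriv (N \<Otimes>\<^sub>M Y) J w \<and> h w > 0"
    by (subst AE_density) auto
  then have "AE w in J. h w = RN_deriv (N \<Otimes>\<^sub>M Y) J w \<and> h w > 0"
    by (simp only: Jd)
  then have AE: "AE w in J. entropy_density 2 (N \<Otimes>\<^sub>M Y) J w = - log 2 (?a * ?f (snd w))"
  proof eventually_elim
    case (elim w)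
    then have "snd w - fst w \<in> A" "?f (snd w) > 0"
      using noise_density_nonneg[of N "snd w"] measure_A_pos
      by (auto simp: h_def indicator_def ennreal_less_zero_iff less_le split: if_splits)
    then have "enn2real (h w) = 1 / (?a * ?f (snd w))" using measure_A_pos by (simp add: h_def)
    with elim have "enn2real (RN_deriv (N \<Otimes>\<^sub>M Y) J w) = 1 / (?a * ?f (snd w))" by simp
    then show ?case by (simp only: entropy_density_def comp_def log_recip)
  qed
  let ?b = "\<lambda>w. - log 2 (?a * ?f (snd w))"
  have b0: "0 \<le> ?b w" for w
    using log2_nonpos[OF _ noise_density_le[OF N, of "snd w"]] noise_density_nonneg[of N "snd w"]
    by simp
  have mi: "mutual_info (N \<Otimes>\<^sub>M Z) borel borel fst (\<lambda>(t, z). t + z) = kl_div (N \<Otimes>\<^sub>M Y) J"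
    by (simp add: mutual_info_def dN dY J_def)
  show ?thesis
  proof (cases "integrable J (entropy_density 2 (N \<Otimes>\<^sub>M Y) J)")
    case True
    then have int: "integrable J ?b"
      using AE by (subst integrable_cong_AE[symmetric]) auto
    \<comment> \<open>A lower bound suffices here: either branch of \<open>kl_div\<close> is at
      least the real divergence.\<close>
    have "kl_div (N \<Otimes>\<^sub>M Y) J \<ge> ereal (KL_divergence 2 (N \<Otimes>\<^sub>M Y) J)"
      by (simp add: kl_div_def)
    moreover have "KL_divergence 2 (N \<Otimes>\<^sub>M Y) J = (\<integral>w. ?b w \<partial>J)"
      unfolding KL_divergence_def using AE by (intro integral_cong_AE) auto
    moreover have "(\<integral>\<^sup>+w. ennreal (?b w) \<partial>J) = ennreal (\<integral>w. ?b w \<partial>J)"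
      using int b0 by (intro nn_integral_eq_integral) auto
    moreover have "0 \<le> (\<integral>w. ?b w \<partial>J)"
      using b0 by (intro integral_nonneg_AE) auto
    ultimately show ?thesis
      by (simp add: mi nnJ enn2ereal_ennreal)
  next
    case False
    then show ?thesis by (simp add: mi kl_div_def)
  qed
qed

end

section \<open>Entropy bound for one test channel\<close>

text \<open>\<open>J\<close> stands for the joint law of the source and its reproduction under a
  test channel; the distortion constraint enters only in the theorem.\<close>

locale rsuq_coupling = rsuq_setup G P A + J: prob_space J
  for G :: "real^'n^'n" and P A :: "(real^'n) set" and J :: "((real^'n) \<times> (real^'n)) measure" +
  assumes sets_J[measurable_cong]: "sets J = sets (borel \<Otimes>\<^sub>M borel)"
begin

definition "PX = distr J borel fst"
definition "PY = distr J borel snd"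
definition "PT = distr J borel (\<lambda>z. fst z - snd z)"

lemma sets_marginals[measurable_cong, simp]:
  "sets PX = sets borel" "sets PY = sets borel" "sets PT = sets borel"
  by (simp_all add: PX_def PY_def PT_def)

lemma space_marginals[simp]: "space PX = UNIV" "space PY = UNIV" "space PT = UNIV"
  by (simp_all add: PX_def PY_def PT_def)

lemma prob_space_marginals: "prob_space PX" "prob_space PY" "prob_space PT"
  unfolding PX_def PY_def PT_def by (auto intro!: J.prob_space_distr)

sublocale X: prob_space PX by (rule prob_space_marginals)
sublocale Y: prob_space PY by (rule prob_space_marginals)
sublocale XY: pair_prob_space PX PY ..
sublocale L: prob_space L by (rule prob_space_L)

section \<open>Atoms of the output given the state, and the mass of the guess\<close>

abbreviation R where "R x s \<equiv> rsuq G P A x s"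
abbreviation f where "f \<equiv> noise_density PT"

lemmas measurable_f[measurable] = measurable_noise_density[OF prob_space_marginals(3) sets_marginals(3)]

text \<open>For a source independent of the state, \<open>mass s y\<close> is the conditional
  probability of the output \<open>y\<close> given the state \<open>s\<close>. \<open>atom\<close>
  evaluates it at the actual output, so the mean of \<open>- log 2 (atom x s)\<close> is the
  conditional entropy.\<close>

definition mass where "mass s y = measure PX {x. R x s = y}"
definition atom where "atom x s = mass s (R x s)"

lemma atom_nonneg: "0 \<le> atom x s" by (simp add: atom_def mass_def)
lemma atom_le_1: "atom x s \<le> 1" by (simp add: atom_def mass_def)

lemma measurable_atom[measurable]:
  "(\<lambda>w. atom (fst w) (snd w)) \<in> borel_measurable (borel \<Otimes>\<^sub>M state_space)"
proof -
  have "{z \<in> space ((borel \<Otimes>\<^sub>M state_space) \<Otimes>\<^sub>M PX). R (snd z) (snd (fst z)) = R (fst (fst z)) (snd (fst z))}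
      \<in> sets ((borel \<Otimes>\<^sub>M state_space) \<Otimes>\<^sub>M PX)"
    by measurable
  from X.measurable_emeasure_Pair[OF this]
  have "(\<lambda>w. emeasure PX {x'. R x' (snd w) = R (fst w) (snd w)}) \<in> borel_measurable (borel \<Otimes>\<^sub>M state_space)"
    by (simp add: space_pair_measure space_PiM PiE_UNIV_domain vimage_def)
  then show ?thesis
    unfolding atom_def mass_def measure_def by measurable
qed

lemmas measurable_atom'[measurable (raw)] =
  measurable_compose[OF measurable_Pair measurable_atom, simplified]

text \<open>There are countably many grid points, and each one of mass 0 is missed almost surely,
  hence all of them at once.\<close>

lemma AE_atom_pos: "AE x in PX. 0 < atom x s"
proof -
  have "AE x in PX. R x s = y \<longrightarrow> mass s y > 0" for y
  proof (cases "mass s y = 0")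
    case True
    have "emeasure PX {x \<in> space PX. R x s = y} = 0"
      using True by (simp add: mass_def X.emeasure_eq_measure)
    then have "AE x in PX. \<not> (R x s = y)"
      by (intro AE_I[where N="{x \<in> space PX. R x s = y}"]) auto
    then show ?thesis by eventually_elim simp
  next
    case False
    then have "mass s y > 0" by (simp add: mass_def zero_less_measure_iff less_le)
    then show ?thesis by simp
  qed
  then have "AE x in PX. \<forall>k j. R x s = s k + lattice_pt G j \<longrightarrow> mass s (s k + lattice_pt G j) > 0"
    by (simp add: AE_all_countable)
  then show ?thesis
  proof eventually_elim
    case (elim x)
    with rsuq_grid[of x s] show ?case by (auto simp: atom_def)
  qed
qed

text \<open>A geometric law: its logarithm is affine in \<open>k\<close>, so the mean cost follows
  from the mean index. The ratio \<open>exp (- accept_prob)\<close>, in place of the ratio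
  \<open>1 - accept_prob\<close> of the index itself, keeps all weights positive even for acceptance
  probability 1.\<close>

definition weight :: "nat \<Rightarrow> real" where
  "weight k = (1 - exp (- accept_prob)) * exp (- accept_prob * real k)"

lemma weight_pos: "0 < weight k"
  using accept_prob_pos by (simp add: weight_def)

lemma sum_weight: "(\<integral>\<^sup>+k. ennreal (weight k) \<partial>count_space UNIV) = 1"
proof -
  have "(\<lambda>k. exp (- accept_prob) ^ k) sums (1 / (1 - exp (- accept_prob)))"
    using accept_prob_pos by (intro geometric_sums) auto
  from sums_mult[OF this, of "1 - exp (- accept_prob)"]
  have "weight sums 1"
    using accept_prob_pos by (simp add: weight_def[abs_def] exp_of_nat2_mult[symmetric] mult.commute)
  then have "(\<Sum>k. ennreal (weight k)) = ennreal 1"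
    using weight_pos by (intro suminf_ennreal_eq) (auto intro: less_imp_le)
  then show ?thesis by (simp add: nn_integral_count_space_nat)
qed

text \<open>The coordinate \<open>s k\<close> is uniform on the cell, so averaging over it unfolds
  the lattice sum into the integral of a probability density divided by \<mu>(P), for every centre
  \<open>c\<close>; the weights sum to 1. After multiplication by \<mu>(P) the guess has mean mass
  1.\<close>

lemma nn_integral_grid_sum:
  "(\<integral>\<^sup>+s. \<integral>\<^sup>+k. \<integral>\<^sup>+j. ennreal (weight k * f (s k + lattice_pt G j - c))
      \<partial>count_space UNIV \<partial>count_space UNIV \<partial>L) = 1 / emeasure lborel P"
proof -
  note [measurable (raw)] = borel_measurable_nn_integral_count_space
  have "(\<integral>\<^sup>+s. \<integral>\<^sup>+k. \<integral>\<^sup>+j. ennreal (weight k * f (s k + lattice_pt G j - c))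
      \<partial>count_space UNIV \<partial>count_space UNIV \<partial>L)
      = (\<integral>\<^sup>+k. \<integral>\<^sup>+s. \<integral>\<^sup>+j. ennreal (weight k * f (s k + lattice_pt G j - c))
      \<partial>count_space UNIV \<partial>L \<partial>count_space UNIV)"
    by (intro nn_integral_count_space_nn_integral) measurable
  also have "\<dots> = (\<integral>\<^sup>+k. ennreal (weight k) * (1 / emeasure lborel P) \<partial>count_space UNIV)"
  proof (rule nn_integral_cong)
    fix k
    have "(\<integral>\<^sup>+s. \<integral>\<^sup>+j. ennreal (weight k * f (s k + lattice_pt G j - c)) \<partial>count_space UNIV \<partial>L)
        = (\<integral>\<^sup>+v. \<integral>\<^sup>+j. ennreal (weight k * f (v + lattice_pt G j - c)) \<partial>count_space UNIV \<partial>distr L U (\<lambda>s. s k))"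
      by (subst nn_integral_distr) measurable
    also have "\<dots> = (\<integral>\<^sup>+v. \<integral>\<^sup>+j. ennreal (weight k * f (v + - c + lattice_pt G j)) \<partial>count_space UNIV \<partial>U)"
      by (simp add: distr_L_component algebra_simps)
    also have "\<dots> = (\<integral>\<^sup>+x. ennreal (weight k * f x) \<partial>lborel) / emeasure lborel P"
      by (rule unfolding_integral_U) measurable
    also have "(\<integral>\<^sup>+x. ennreal (weight k * f x) \<partial>lborel) = ennreal (weight k) * (\<integral>\<^sup>+x. ennreal (f x) \<partial>lborel)"
      using weight_pos[of k]
      by (subst nn_integral_cmult[symmetric]) (auto simp: ennreal_mult noise_density_nonneg)
    also have "(\<integral>\<^sup>+x. ennreal (f x) \<partial>lborel) = 1"
      by (rule nn_integral_noise_density) (rule prob_space_marginals sets_marginals)+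
    finally show "(\<integral>\<^sup>+s. \<integral>\<^sup>+j. ennreal (weight k * f (s k + lattice_pt G j - c)) \<partial>count_space UNIV \<partial>L)
        = ennreal (weight k) * (1 / emeasure lborel P)"
      by (simp add: ennreal_times_divide)
  qed
  also have "\<dots> = 1 / emeasure lborel P"
    by (subst nn_integral_multc) (auto simp: sum_weight)
  finally show ?thesis .
qed

text \<open>Integration over the source cancels \<open>atom\<close>: a grid point is hit with
  probability equal to its mass.\<close>

lemma nn_integral_over_atoms:
  "(\<integral>\<^sup>+x. ennreal (weight (accept_index x s) * f (R x s - c) / atom x s) \<partial>PX)
    \<le> (\<integral>\<^sup>+k. \<integral>\<^sup>+j. ennreal (weight k * f (s k + lattice_pt G j - c)) \<partial>count_space UNIV \<partial>count_space UNIV)"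
proof -
  have "{x \<in> space PX. R x s = y} \<in> sets PX" for y by measurable
  then have [measurable]: "{x. R x s = y} \<in> sets borel" for y by simp
  note [measurable (raw)] = borel_measurable_nn_integral_count_space
  let ?y = "\<lambda>k j. s k + lattice_pt G j"
  let ?h = "\<lambda>k j x. ennreal (weight k * f (?y k j - c) / mass s (?y k j)) * indicator {x. R x s = ?y k j} x"
  have "(\<integral>\<^sup>+x. ennreal (weight (accept_index x s) * f (R x s - c) / atom x s) \<partial>PX) \<le>
      (\<integral>\<^sup>+x. \<integral>\<^sup>+k. \<integral>\<^sup>+j. ?h k j x \<partial>count_space UNIV \<partial>count_space UNIV \<partial>PX)"
  \<comment> \<open>Grids with different \<open>k\<close> may share points. The right side then
    counts the output several times, which is harmless for an upper bound.\<close>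
  proof (rule nn_integral_mono)
    fix x
    let ?k = "accept_index x s"
    obtain j where j: "R x s = ?y ?k j" using rsuq_grid[of x s] by blast
    have "ennreal (weight ?k * f (R x s - c) / atom x s) = ?h ?k j x"
      using j by (simp add: atom_def)
    also have "\<dots> \<le> (\<integral>\<^sup>+j. ?h ?k j x \<partial>count_space UNIV)"
      by (rule nn_integral_ge_point) simp
    also have "\<dots> \<le> (\<integral>\<^sup>+k. \<integral>\<^sup>+j. ?h k j x \<partial>count_space UNIV \<partial>count_space UNIV)"
      by (rule nn_integral_ge_point) simp
    finally show "ennreal (weight ?k * f (R x s - c) / atom x s)
      \<le> (\<integral>\<^sup>+k. \<integral>\<^sup>+j. ?h k j x \<partial>count_space UNIV \<partial>count_space UNIV)" .
  qed
  also have "\<dots> = (\<integral>\<^sup>+k. \<integral>\<^sup>+x. \<integral>\<^sup>+j. ?h k j x \<partial>count_space UNIV \<partial>PX \<partial>count_space UNIV)"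
    by (intro nn_integral_count_space_nn_integral) measurable
  also have "\<dots> = (\<integral>\<^sup>+k. \<integral>\<^sup>+j. \<integral>\<^sup>+x. ?h k j x \<partial>PX \<partial>count_space UNIV \<partial>count_space UNIV)"
    by (intro nn_integral_cong nn_integral_count_space_nn_integral) measurable
  also have "\<dots> \<le> (\<integral>\<^sup>+k. \<integral>\<^sup>+j. ennreal (weight k * f (?y k j - c)) \<partial>count_space UNIV \<partial>count_space UNIV)"
  proof (intro nn_integral_mono)
    fix k j
    let ?c = "weight k * f (?y k j - c)" and ?m = "mass s (?y k j)"
    have nn: "0 \<le> ?c" "0 \<le> ?m"
      using weight_pos[of k] noise_density_nonneg by (auto simp: mass_def)
    have "(\<integral>\<^sup>+x. ?h k j x \<partial>PX) = ennreal (?c / ?m) * ennreal ?m"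
      by (subst nn_integral_cmult_indicator) (auto simp: mass_def X.emeasure_eq_measure)
    also have "\<dots> = ennreal (?c / ?m * ?m)"
      using nn by (intro ennreal_mult[symmetric]) auto
    \<comment> \<open>At a point of mass 0 the quotient is 0 by convention, hence an
      inequality.\<close>
    also have "\<dots> \<le> ennreal ?c"
      using nn by (intro ennreal_leI) (cases "?m = 0", auto)
    finally show "(\<integral>\<^sup>+x. ?h k j x \<partial>PX) \<le> ennreal ?c" .
  qed
  finally show ?thesis .
qed

section \<open>Density of the coupling and mean of the ratio \<open>W\<close>\<close>

definition g where "g z = enn2real (RN_deriv (PX \<Otimes>\<^sub>M PY) J z)"

lemma measurable_g[measurable]: "g \<in> borel_measurable (borel \<Otimes>\<^sub>M borel)"
proof -
  have "g \<in> borel_measurable (PX \<Otimes>\<^sub>M PY)" unfolding g_def by measurable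
  then show ?thesis by measurable
qed

lemma sets_XY: "sets (PX \<Otimes>\<^sub>M PY) = sets (borel \<Otimes>\<^sub>M borel)"
  by (intro sets_pair_measure_cong) auto

lemma RN_finite:
  assumes "absolutely_continuous (PX \<Otimes>\<^sub>M PY) J"
  shows "AE z in PX \<Otimes>\<^sub>M PY. RN_deriv (PX \<Otimes>\<^sub>M PY) J z = ennreal (g z)"
proof -
  have "AE z in PX \<Otimes>\<^sub>M PY. RN_deriv (PX \<Otimes>\<^sub>M PY) J z \<noteq> \<infinity>"
    using assms sets_J sets_XY by (intro XY.RN_deriv_finite J.sigma_finite_measure_axioms) auto
  then show ?thesis
    by eventually_elim (simp add: g_def less_top)
qed

lemma density_J:
  assumes "absolutely_continuous (PX \<Otimes>\<^sub>M PY) J"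
  shows "J = density (PX \<Otimes>\<^sub>M PY) (\<lambda>z. ennreal (g z))"
proof -
  have "density (PX \<Otimes>\<^sub>M PY) (RN_deriv (PX \<Otimes>\<^sub>M PY) J) = J"
    using assms by (intro XY.density_RN_deriv) (simp_all add: sets_J sets_XY)
  moreover have "density (PX \<Otimes>\<^sub>M PY) (RN_deriv (PX \<Otimes>\<^sub>M PY) J) = density (PX \<Otimes>\<^sub>M PY) (\<lambda>z. ennreal (g z))"
    using RN_finite[OF assms] by (intro density_cong) measurable
  ultimately show ?thesis by simp
qed

lemma g_nonneg: "0 \<le> g z" by (simp add: g_def)

lemma AE_g_pos:
  assumes "absolutely_continuous (PX \<Otimes>\<^sub>M PY) J"
  shows "AE z in J. 0 < g z"
  by (subst density_J[OF assms], subst AE_density) auto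

text \<open>Division by a vanishing \<open>atom\<close> or \<open>g\<close> gives 0, which is
  harmless for the upper bound on the mean.\<close>

definition W where
  "W z s = measure lborel P * (weight (accept_index (fst z) s) * f (R (fst z) s - snd z) / atom (fst z) s) / g z"

lemma measurable_W[measurable]:
  "(\<lambda>w. W (fst w) (snd w)) \<in> borel_measurable ((borel \<Otimes>\<^sub>M borel) \<Otimes>\<^sub>M state_space)"
  unfolding W_def by measurable

lemma W_nonneg: "0 \<le> W z s"
  using weight_pos noise_density_nonneg atom_nonneg g_nonneg by (simp add: W_def less_imp_le)

text \<open>The denominator \<open>g\<close> replaces \<open>J\<close> by the product of its
  marginals. With \<open>y\<close> and the state fixed, the integral over the source cancels
  \<open>atom\<close>; the mean over the state then gives 1 / \<mu>(P), against the factor \<mu>(P)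
  in \<open>W\<close>.\<close>

lemma W_expectation_le:
  assumes ac: "absolutely_continuous (PX \<Otimes>\<^sub>M PY) J"
  shows "(\<integral>\<^sup>+z. \<integral>\<^sup>+s. ennreal (W z s) \<partial>L \<partial>J) \<le> 1"
proof -
  interpret LX: pair_sigma_finite L PX ..
  let ?H = "\<lambda>x y s. weight (accept_index x s) * f (R x s - y) / atom x s"
  have H0: "0 \<le> ?H x y s" for x y s
    using weight_pos noise_density_nonneg atom_nonneg by (simp add: less_imp_le)
  have [measurable]: "W z \<in> borel_measurable state_space" for z
    unfolding W_def[abs_def] by measurable
  let ?P = "measure lborel P"
  have "(\<integral>\<^sup>+z. \<integral>\<^sup>+s. ennreal (W z s) \<partial>L \<partial>J)
      = (\<integral>\<^sup>+z. ennreal (g z) * (\<integral>\<^sup>+s. ennreal (W z s) \<partial>L) \<partial>(PX \<Otimes>\<^sub>M PY))"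
    by (subst density_J[OF ac], subst nn_integral_density) auto
  also have "\<dots> \<le> (\<integral>\<^sup>+z. \<integral>\<^sup>+s. ennreal (?P * ?H (fst z) (snd z) s) \<partial>L \<partial>(PX \<Otimes>\<^sub>M PY))"
  proof (intro nn_integral_mono)
    fix z
    have "ennreal (g z) * (\<integral>\<^sup>+s. ennreal (W z s) \<partial>L) = (\<integral>\<^sup>+s. ennreal (g z) * ennreal (W z s) \<partial>L)"
      by (intro nn_integral_cmult[symmetric]) measurable
    also have "\<dots> \<le> (\<integral>\<^sup>+s. ennreal (?P * ?H (fst z) (snd z) s) \<partial>L)"
    proof (intro nn_integral_mono)
      fix s
      have "ennreal (g z) * ennreal (W z s) = ennreal (g z * W z s)"
        using W_nonneg g_nonneg by (simp add: ennreal_mult)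
      \<comment> \<open>An equality except where \<open>g\<close> vanishes; there the left side is
        0.\<close>
      also have "\<dots> \<le> ennreal (?P * ?H (fst z) (snd z) s)"
        using mult_nonneg_nonneg[OF measure_nonneg H0, of lborel P]
        by (intro ennreal_leI) (cases "g z = 0", auto simp: W_def)
      finally show "ennreal (g z) * ennreal (W z s) \<le> ennreal (?P * ?H (fst z) (snd z) s)" .
    qed
    finally show "ennreal (g z) * (\<integral>\<^sup>+s. ennreal (W z s) \<partial>L) \<le> (\<integral>\<^sup>+s. ennreal (?P * ?H (fst z) (snd z) s) \<partial>L)" .
  qed
  also have "\<dots> = (\<integral>\<^sup>+y. \<integral>\<^sup>+x. \<integral>\<^sup>+s. ennreal (?P * ?H x y s) \<partial>L \<partial>PX \<partial>PY)"
    by (subst XY.nn_integral_snd[symmetric]) auto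
  also have "\<dots> = (\<integral>\<^sup>+y. \<integral>\<^sup>+s. \<integral>\<^sup>+x. ennreal (?P * ?H x y s) \<partial>PX \<partial>L \<partial>PY)"
    by (intro nn_integral_cong LX.Fubini') measurable
  also have "\<dots> \<le> (\<integral>\<^sup>+y. \<integral>\<^sup>+s. ennreal ?P * (\<integral>\<^sup>+k. \<integral>\<^sup>+j. ennreal (weight k * f (s k + lattice_pt G j - y))
      \<partial>count_space UNIV \<partial>count_space UNIV) \<partial>L \<partial>PY)"
  proof (intro nn_integral_mono)
    fix y s
    have "(\<integral>\<^sup>+x. ennreal (?P * ?H x y s) \<partial>PX) = ennreal ?P * (\<integral>\<^sup>+x. ennreal (?H x y s) \<partial>PX)"
      by (subst nn_integral_cmult[symmetric]) (auto simp only: ennreal_mult[OF measure_nonneg H0], measurable)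
    also have "\<dots> \<le> ennreal ?P * (\<integral>\<^sup>+k. \<integral>\<^sup>+j. ennreal (weight k * f (s k + lattice_pt G j - y))
      \<partial>count_space UNIV \<partial>count_space UNIV)"
      by (intro mult_left_mono nn_integral_over_atoms) auto
    finally show "(\<integral>\<^sup>+x. ennreal (?P * ?H x y s) \<partial>PX) \<le> \<dots>" .
  qed
  also have "\<dots> = (\<integral>\<^sup>+y. ennreal ?P * (1 / emeasure lborel P) \<partial>PY)"
  proof (intro nn_integral_cong)
    note [measurable (raw)] = borel_measurable_nn_integral_count_space
    fix y
    show "(\<integral>\<^sup>+s. ennreal ?P * (\<integral>\<^sup>+k. \<integral>\<^sup>+j. ennreal (weight k * f (s k + lattice_pt G j - y))
      \<partial>count_space UNIV \<partial>count_space UNIV) \<partial>L) = ennreal ?P * (1 / emeasure lborel P)"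
      unfolding nn_integral_grid_sum[of y, symmetric]
      by (intro nn_integral_cmult) measurable
  qed
  also have "\<dots> = 1"
    using measure_P_pos Y.emeasure_space_1
    by (simp add: emeasure_P_eq ennreal_times_divide ennreal_divide_self)
  finally show ?thesis .
qed

text \<open>Write \<open>Q - Y = (X - Y) + (Q - X)\<close>: by \<open>rsuq_law\<close> the second
  summand is uniform on \<open>A\<close> whatever the pair \<open>(X, Y)\<close> is, and the first
  is \<open>T\<close>.\<close>

lemma nn_integral_error_law:
  assumes [measurable]: "h \<in> borel_measurable borel"
  shows "(\<integral>\<^sup>+z. \<integral>\<^sup>+s. h (R (fst z) s - snd z) \<partial>L \<partial>J) = (\<integral>\<^sup>+t. \<integral>\<^sup>+z. h (t + z) \<partial>Z \<partial>PT)"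
proof -
  interpret Z: prob_space Z by (rule prob_space_Z)
  have "(\<integral>\<^sup>+t. \<integral>\<^sup>+z. h (t + z) \<partial>Z \<partial>PT) = (\<integral>\<^sup>+w. \<integral>\<^sup>+z. h (fst w - snd w + z) \<partial>Z \<partial>J)"
    unfolding PT_def by (subst nn_integral_distr) auto
  also have "\<dots> = (\<integral>\<^sup>+w. \<integral>\<^sup>+s. h (R (fst w) s - snd w) \<partial>L \<partial>J)"
    by (intro nn_integral_cong, subst rsuq_law[where h="\<lambda>y. h (y - snd _)"]) (auto simp: algebra_simps)
  finally show ?thesis by simp
qed

text \<open>\<open>Q - Y\<close> has density \<open>f\<close>, so it avoids the zeros of
  \<open>f\<close> almost surely.\<close>

lemma AE_noise_density_pos: "AE w in J \<Otimes>\<^sub>M L. 0 < f (R (fst (fst w)) (snd w) - snd (fst w))"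
proof -
  have "(\<integral>\<^sup>+w. indicator {y. f y = 0} (R (fst (fst w)) (snd w) - snd (fst w)) \<partial>(J \<Otimes>\<^sub>M L))
      = (\<integral>\<^sup>+z. \<integral>\<^sup>+s. indicator {y. f y = 0} (R (fst z) s - snd z) \<partial>L \<partial>J)"
    by (subst L.nn_integral_fst[symmetric]) auto
  also have "\<dots> = (\<integral>\<^sup>+y. indicator {y. f y = 0} y * ennreal (f y) \<partial>lborel)"
    by (subst nn_integral_error_law, measurable, rule nn_integral_noisy_sum)
       (auto intro: prob_space_marginals)
  also have "\<dots> = (\<integral>\<^sup>+(y::real^'n). 0 \<partial>lborel)"
    by (intro nn_integral_cong) (auto simp: indicator_def)
  also have "\<dots> = 0" by simp
  finally have "AE w in J \<Otimes>\<^sub>M L.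
      indicator {y. f y = 0} (R (fst (fst w)) (snd w) - snd (fst w)) = (0::ennreal)"
    by (subst (asm) nn_integral_0_iff_AE) auto
  then show ?thesis
    by eventually_elim (use noise_density_nonneg in \<open>auto simp: indicator_def less_le\<close>)
qed

section \<open>Almost sure estimates and their integration\<close>

lemma AE_J_fst: "AE x in PX. Q x \<Longrightarrow> AE z in J. Q (fst z)"
  unfolding PX_def by (rule AE_distrD) auto

text \<open>\<open>AE_atom_pos\<close> fixes the state first; exchanging the two quantifiers is
  Fubini and rests on the joint measurability of \<open>atom\<close>.\<close>

lemma AE_atom_pos_pair: "AE w in J \<Otimes>\<^sub>M L. 0 < atom (fst (fst w)) (snd w)"
proof -
  interpret JL: pair_sigma_finite J L ..
  have "AE s in L. AE z in J. 0 < atom (fst z) s"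
    by (intro AE_I2 AE_J_fst AE_atom_pos)
  then have "AE z in J. AE s in L. 0 < atom (fst z) s"
    by (subst JL.AE_commute) auto
  then show ?thesis
    by (intro JL.AE_pair_measure) auto
qed

lemma AE_pair_J: "AE z in J. Q z \<Longrightarrow> AE w in J \<Otimes>\<^sub>M L. Q (fst w)"
  by (subst (asm) L.distr_pair_fst[of J, symmetric]) (rule AE_distrD[rotated], auto)

text \<open>Let p be the acceptance probability. As the mean index is (1 - p) / p, the cost in nats
  is - ln (1 - exp (- p)) + 1 - p. From exp p \<ge> 1 + p follows 1 - exp (- p) \<ge> p * exp (- p),
  so the first term is at most p - ln p and the total at most 1 - ln p.\<close>

lemma nn_integral_log_weight:
  "(\<integral>\<^sup>+s. ennreal (- log 2 (weight (accept_index x s))) \<partial>L)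
    \<le> ennreal ((1 - ln accept_prob) / ln 2)"
proof -
  let ?p = accept_prob
  let ?c = "- ln (1 - exp (- ?p)) / ln 2"
  have e: "0 < 1 - exp (- ?p)" "1 - exp (- ?p) < 1" using accept_prob_pos by auto
  have c: "0 \<le> ?c" using e by (auto simp: divide_nonpos_pos)
  have "- log 2 (weight k) = ?c + ?p / ln 2 * real k" for k
    using e by (simp add: weight_def log_def ln_mult diff_divide_distrib add_divide_distrib)
  then have "(\<integral>\<^sup>+s. ennreal (- log 2 (weight (accept_index x s))) \<partial>L)
      = (\<integral>\<^sup>+s. ennreal ?c + ennreal (?p / ln 2) * ennreal (real (accept_index x s)) \<partial>L)"
    using c accept_prob_pos
    by (intro nn_integral_cong) (simp add: ennreal_plus[symmetric] ennreal_mult[symmetric] del: ennreal_plus)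
  also have "\<dots> = ennreal ?c + ennreal (?p / ln 2) * ennreal ((1 - ?p) / ?p)"
    using L.emeasure_space_1 by (simp add: nn_integral_add nn_integral_cmult nn_integral_accept_index)
  also have "\<dots> = ennreal (?c + ?p / ln 2 * ((1 - ?p) / ?p))"
    using c accept_prob_pos accept_prob_le_1 by (simp add: ennreal_plus[symmetric] ennreal_mult[symmetric] del: ennreal_plus)
  also have "\<dots> \<le> ennreal ((1 - ln ?p) / ln 2)"
  proof (rule ennreal_leI)
    have "?p + 1 \<le> exp ?p" by (metis add.commute exp_ge_add_one_self)
    then have "?p * exp (- ?p) \<le> 1 - exp (- ?p)"
      by (simp add: exp_minus field_simps)
    then have "ln (?p * exp (- ?p)) \<le> ln (1 - exp (- ?p))"
      using e accept_prob_pos by (subst ln_le_cancel_iff) auto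
    then have "ln ?p - ?p \<le> ln (1 - exp (- ?p))"
      using accept_prob_pos by (simp add: ln_mult)
    moreover have "?c + ?p / ln 2 * ((1 - ?p) / ?p) = (- ln (1 - exp (- ?p)) + (1 - ?p)) / ln 2"
      using accept_prob_pos by (simp add: field_simps)
    ultimately show "?c + ?p / ln 2 * ((1 - ?p) / ?p) \<le> (1 - ln ?p) / ln 2"
      by (simp add: divide_right_mono)
  qed
  finally show ?thesis .
qed

text \<open>This is ln W \<le> W - 1 in bits with the logarithm of the product expanded; the
  positivity assumptions allow every factor to be split off.\<close>

lemma log_bound:
  assumes "0 < atom x s" "0 < g (x, y)" "0 < f (R x s - y)"
  shows "- log 2 (atom x s) + (1 / ln 2 - log 2 accept_prob)
    \<le> log 2 (g (x, y)) - log 2 (weight (accept_index x s))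
      - log 2 (measure lborel A * f (R x s - y)) + W (x, y) s / ln 2"
proof -
  let ?w = "weight (accept_index x s)"
  have pos: "0 < ?w" "0 < W (x, y) s"
    using assms weight_pos measure_P_pos by (auto simp: W_def)
  have "ln (W (x, y) s) \<le> W (x, y) s - 1"
    using pos by (intro ln_le_minus_one)
  then have "log 2 (W (x, y) s) \<le> (W (x, y) s - 1) / ln 2"
    unfolding log_def by (intro divide_right_mono) auto
  moreover have "log 2 (W (x, y) s) = log 2 (measure lborel P) + (log 2 ?w + log 2 (f (R x s - y))
      - log 2 (atom x s)) - log 2 (g (x, y))"
    using assms pos measure_P_pos by (simp add: W_def log_mult log_divide)
  \<comment> \<open>Trades \<mu>(P) for \<mu>(A), so that the noise term becomes the nonnegative
    information density of the noisy channel.\<close>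
  moreover have "log 2 accept_prob = log 2 (measure lborel A) - log 2 (measure lborel P)"
    using measure_P_pos measure_A_pos by (simp add: accept_prob_def log_divide)
  moreover have "log 2 (measure lborel A * f (R x s - y)) = log 2 (measure lborel A) + log 2 (f (R x s - y))"
    using assms measure_A_pos by (simp add: log_mult)
  ultimately show ?thesis by (simp add: diff_divide_distrib)
qed

lemma weight_le_1: "weight k \<le> 1"
  using accept_prob_pos by (auto simp: weight_def intro!: mult_le_one)

text \<open>Integrate \<open>log_bound\<close> over the coupling and the state. To exclude
  \<infinity> - \<infinity>, the terms are first arranged so that both sides are sums of nonnegative
  functions, the sign-changing \<open>log 2 (g z)\<close> being split into its two parts.\<close>

lemma entropy_bound:
  assumes ac: "absolutely_continuous (PX \<Otimes>\<^sub>M PY) J"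
    and int: "integrable J (entropy_density 2 (PX \<Otimes>\<^sub>M PY) J)"
  shows "enn2ereal (\<integral>\<^sup>+s. \<integral>\<^sup>+x. ennreal (- log 2 (atom x s)) \<partial>PX \<partial>L)
    \<le> ereal (KL_divergence 2 (PX \<Otimes>\<^sub>M PY) J)
      + enn2ereal (\<integral>\<^sup>+t. \<integral>\<^sup>+z. ennreal (- log 2 (measure lborel A * f (t + z))) \<partial>Z \<partial>PT)
      + ereal (log 2 (exp 1))"
    (is "enn2ereal ?H \<le> _ + enn2ereal ?B + _")
proof -
  interpret JL: pair_prob_space J L ..
  let ?p = accept_prob and ?a = "measure lborel A"
  let ?k = "\<lambda>w. accept_index (fst (fst w)) (snd w)"
  let ?f = "\<lambda>w. ?a * f (R (fst (fst w)) (snd w) - snd (fst w))"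
  let ?c = "1 / ln 2 - log 2 ?p"
  have ed: "entropy_density 2 (PX \<Otimes>\<^sub>M PY) J = (\<lambda>z. log 2 (g z))"
    by (auto simp: entropy_density_def g_def)
  have l2: "0 \<le> 1 / ln (2::real)" by simp
  have "log 2 ?p \<le> 0"
    using log2_nonpos[of ?p] accept_prob_pos accept_prob_le_1 by simp
  \<comment> \<open>Nonnegativity keeps \<open>ennreal ?c\<close> from being truncated.\<close>
  with l2 have c: "0 \<le> ?c" by linarith
  define Gp where "Gp = (\<integral>\<^sup>+z. ennreal (log 2 (g z)) \<partial>J)"
  define Gm where "Gm = (\<integral>\<^sup>+z. ennreal (- log 2 (g z)) \<partial>J)"
  have fin: "Gp \<noteq> \<infinity>" "Gm \<noteq> \<infinity>"
    using int unfolding ed real_integrable_def Gp_def Gm_def by auto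
  have KL: "KL_divergence 2 (PX \<Otimes>\<^sub>M PY) J = enn2real Gp - enn2real Gm"
    using int unfolding KL_divergence_def ed Gp_def Gm_def by (rule real_lebesgue_integral_def)
  have marg: "(\<integral>\<^sup>+w. h (fst w) \<partial>(J \<Otimes>\<^sub>M L)) = (\<integral>\<^sup>+z. h z \<partial>J)"
    if [measurable]: "h \<in> borel_measurable (borel \<Otimes>\<^sub>M borel)" for h :: "_ \<Rightarrow> ennreal"
    using L.emeasure_space_1 by (subst L.nn_integral_fst[symmetric]) auto
  have "AE w in J \<Otimes>\<^sub>M L. ennreal (- log 2 (atom (fst (fst w)) (snd w))) + ennreal (- log 2 (g (fst w))) + ennreal ?c
      \<le> ennreal (log 2 (g (fst w))) + ennreal (- log 2 (weight (?k w))) + ennreal (- log 2 (?f w))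
        + ennreal (W (fst w) (snd w) / ln 2)"
    using AE_atom_pos_pair AE_noise_density_pos AE_pair_J[OF AE_g_pos[OF ac]]
  proof eventually_elim
    case (elim w)
    obtain x y s where w: "w = ((x, y), s)" by (metis surj_pair)
    have b: "- log 2 (atom x s) + ?c \<le> log 2 (g (x, y)) - log 2 (weight (accept_index x s))
      - log 2 (?a * f (R x s - y)) + W (x, y) s / ln 2"
      using elim by (intro log_bound) (simp_all add: w)
    have nn: "0 \<le> - log 2 (atom x s)" "0 \<le> - log 2 (weight (accept_index x s))"
      "0 \<le> - log 2 (?a * f (R x s - y))" "0 \<le> W (x, y) s / ln 2"
      using log2_nonpos[OF atom_nonneg atom_le_1, of x s] W_nonneg
        log2_nonpos[OF less_imp_le[OF weight_pos] weight_le_1]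
        log2_nonpos[OF _ noise_density_le[OF prob_space_marginals(3)], of "R x s - y"]
        noise_density_nonneg[of PT] by auto
    show ?case
    \<comment> \<open>At most one of the two parts of \<open>log 2 (g (x, y))\<close> is
      nonzero.\<close>
    proof (cases "0 \<le> log 2 (g (x, y))")
      case True
      with b nn c show ?thesis
        by (auto simp: w ennreal_neg ennreal_plus[symmetric] simp del: ennreal_plus intro!: ennreal_leI)
    next
      case False
      with b nn c show ?thesis
        by (auto simp: w ennreal_neg ennreal_plus[symmetric] simp del: ennreal_plus intro!: ennreal_leI)
    qed
  qed
  then have "(\<integral>\<^sup>+w. ennreal (- log 2 (atom (fst (fst w)) (snd w))) + ennreal (- log 2 (g (fst w))) + ennreal ?c \<partial>(J \<Otimes>\<^sub>M L))
      \<le> (\<integral>\<^sup>+w. ennreal (log 2 (g (fst w))) + ennreal (- log 2 (weight (?k w))) + ennreal (- log 2 (?f w))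
        + ennreal (W (fst w) (snd w) / ln 2) \<partial>(J \<Otimes>\<^sub>M L))"
    by (rule nn_integral_mono_AE)
  also have "(\<integral>\<^sup>+w. ennreal (- log 2 (atom (fst (fst w)) (snd w))) + ennreal (- log 2 (g (fst w))) + ennreal ?c \<partial>(J \<Otimes>\<^sub>M L))
      = (\<integral>\<^sup>+w. ennreal (- log 2 (atom (fst (fst w)) (snd w))) \<partial>(J \<Otimes>\<^sub>M L)) + Gm + ennreal ?c"
    using JL.emeasure_space_1 marg[of "\<lambda>z. ennreal (- log 2 (g z))"]
    by (simp add: nn_integral_add Gm_def)
  also have "(\<integral>\<^sup>+w. ennreal (- log 2 (atom (fst (fst w)) (snd w))) \<partial>(J \<Otimes>\<^sub>M L)) = ?H"
  proof -
    have "(\<integral>\<^sup>+w. ennreal (- log 2 (atom (fst (fst w)) (snd w))) \<partial>(J \<Otimes>\<^sub>M L))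
        = (\<integral>\<^sup>+s. \<integral>\<^sup>+z. ennreal (- log 2 (atom (fst z) s)) \<partial>J \<partial>L)"
      by (subst JL.nn_integral_snd[symmetric]) auto
    also have "\<dots> = ?H"
      unfolding PX_def by (intro nn_integral_cong, subst nn_integral_distr) auto
    finally show ?thesis .
  qed
  also have "(\<integral>\<^sup>+w. ennreal (log 2 (g (fst w))) + ennreal (- log 2 (weight (?k w))) + ennreal (- log 2 (?f w))
        + ennreal (W (fst w) (snd w) / ln 2) \<partial>(J \<Otimes>\<^sub>M L))
      = Gp + (\<integral>\<^sup>+w. ennreal (- log 2 (weight (?k w))) \<partial>(J \<Otimes>\<^sub>M L)) + (\<integral>\<^sup>+w. ennreal (- log 2 (?f w)) \<partial>(J \<Otimes>\<^sub>M L))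
        + (\<integral>\<^sup>+w. ennreal (W (fst w) (snd w) / ln 2) \<partial>(J \<Otimes>\<^sub>M L))"
    using marg[of "\<lambda>z. ennreal (log 2 (g z))"]
    by (simp add: nn_integral_add Gp_def)
  also have "\<dots> \<le> Gp + ennreal ((1 - ln ?p) / ln 2) + ?B + ennreal (1 / ln 2)"
  proof (intro add_mono order_refl)
    have "(\<integral>\<^sup>+w. ennreal (- log 2 (weight (?k w))) \<partial>(J \<Otimes>\<^sub>M L))
        = (\<integral>\<^sup>+z. \<integral>\<^sup>+s. ennreal (- log 2 (weight (accept_index (fst z) s))) \<partial>L \<partial>J)"
      by (subst L.nn_integral_fst[symmetric]) auto
    also have "\<dots> \<le> (\<integral>\<^sup>+z. ennreal ((1 - ln ?p) / ln 2) \<partial>J)"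
      by (intro nn_integral_mono nn_integral_log_weight)
    finally show "(\<integral>\<^sup>+w. ennreal (- log 2 (weight (?k w))) \<partial>(J \<Otimes>\<^sub>M L)) \<le> ennreal ((1 - ln ?p) / ln 2)"
      using J.emeasure_space_1 by simp
    have "(\<integral>\<^sup>+w. ennreal (- log 2 (?f w)) \<partial>(J \<Otimes>\<^sub>M L))
        = (\<integral>\<^sup>+z. \<integral>\<^sup>+s. ennreal (- log 2 (?a * f (R (fst z) s - snd z))) \<partial>L \<partial>J)"
      by (subst L.nn_integral_fst[symmetric]) auto
    also have "\<dots> = ?B"
      by (rule nn_integral_error_law) measurable
    finally show "(\<integral>\<^sup>+w. ennreal (- log 2 (?f w)) \<partial>(J \<Otimes>\<^sub>M L)) \<le> ?B" by simp
    have "(\<integral>\<^sup>+w. ennreal (W (fst w) (snd w) / ln 2) \<partial>(J \<Otimes>\<^sub>M L))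
        = (\<integral>\<^sup>+w. ennreal (1 / ln 2) * ennreal (W (fst w) (snd w)) \<partial>(J \<Otimes>\<^sub>M L))"
      by (intro nn_integral_cong) (simp add: ennreal_mult[symmetric] W_nonneg)
    also have "\<dots> = ennreal (1 / ln 2) * (\<integral>\<^sup>+z. \<integral>\<^sup>+s. ennreal (W z s) \<partial>L \<partial>J)"
      by (subst nn_integral_cmult, measurable, subst L.nn_integral_fst[symmetric]) auto
    also have "\<dots> \<le> ennreal (1 / ln 2) * 1"
      by (intro mult_left_mono W_expectation_le[OF ac]) auto
    finally show "(\<integral>\<^sup>+w. ennreal (W (fst w) (snd w) / ln 2) \<partial>(J \<Otimes>\<^sub>M L)) \<le> ennreal (1 / ln 2)"
      by simp
  qed
  finally have main: "?H + Gm + ennreal ?c \<le> Gp + ennreal ((1 - ln ?p) / ln 2) + ?B + ennreal (1 / ln 2)" .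
  \<comment> \<open>The bound on the index cost equals the constant on the left, so the two cancel;
    the remaining constant \<open>1 / ln 2\<close> comes from the mean of \<open>W\<close> and is
    log e.\<close>
  have c': "(1 - ln ?p) / ln 2 = ?c" by (simp add: log_def diff_divide_distrib)
  have e1: "log 2 (exp 1) = 1 / ln 2" by (simp add: log_def)
  show ?thesis
  proof (cases "?B = \<infinity>")
    case True
    then show ?thesis by simp
  next
    case False
    then obtain b where b: "?B = ennreal b" "0 \<le> b" by (cases ?B) auto
    obtain gp where gp: "Gp = ennreal gp" "0 \<le> gp" using fin by (cases Gp) auto
    obtain gm where gm: "Gm = ennreal gm" "0 \<le> gm" using fin by (cases Gm) auto
    \<comment> \<open>\<open>main\<close> bounds \<open>?H\<close> by finite terms; after this the
      common constants can be cancelled in the reals.\<close>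
    have "?H \<noteq> \<infinity>"
      using main unfolding c' b(1) gp(1) gm(1) by (auto simp: top_unique)
    then obtain h where h: "?H = ennreal h" "0 \<le> h" by (cases ?H) auto
    have "ennreal (h + gm + ?c) \<le> ennreal (gp + ?c + b + 1 / ln 2)"
      using main c b gp gm h unfolding c' by (simp add: ennreal_plus[symmetric] del: ennreal_plus)
    then have "h + gm + ?c \<le> gp + ?c + b + 1 / ln 2"
      by (subst (asm) ennreal_le_iff) (intro add_nonneg_nonneg c b gp l2)
    then show ?thesis
      unfolding b(1) h(1) KL gp(1) gm(1) e1 using b gp gm h by (simp add: enn2ereal_ennreal)
  qed
qed

end

section \<open>Conditional laws\<close>

context
  fixes L :: "'a measure" and N :: "'b measure" and K :: "'a \<Rightarrow> 'b measure"
  assumes L: "prob_space L" and K: "K \<in> measurable L (prob_algebra N)"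
begin

private lemma inner[measurable]:
  "(\<lambda>x. K x \<bind> (\<lambda>y. return (L \<Otimes>\<^sub>M N) (x, y))) \<in> measurable L (prob_algebra (L \<Otimes>\<^sub>M N))"
proof -
  have "(\<lambda>(x, y). return (L \<Otimes>\<^sub>M N) (x, y)) \<in> measurable (L \<Otimes>\<^sub>M N) (prob_algebra (L \<Otimes>\<^sub>M N))"
    by (simp add: case_prod_beta')
  with K show ?thesis by (rule measurable_bind_prob_space2)
qed

private lemma L_in: "L \<in> space (prob_algebra L)"
  using L by (simp add: space_prob_algebra)

lemma sets_joint_law: "sets (joint_law L N K) = sets (L \<Otimes>\<^sub>M N)"
  unfolding joint_law_def by (rule sets_bind'[OF L_in inner])

lemma prob_space_joint_law: "prob_space (joint_law L N K)"
  unfolding joint_law_def by (rule prob_space_bind'[OF L_in inner])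

text \<open>\<open>joint_law\<close> is a nested bind, so the integral unfolds in two steps, and the
  innermost \<open>return\<close> collapses to evaluation.\<close>

lemma nn_integral_joint_law:
  assumes [measurable]: "h \<in> borel_measurable (L \<Otimes>\<^sub>M N)"
  shows "(\<integral>\<^sup>+z. h z \<partial>joint_law L N K) = (\<integral>\<^sup>+x. \<integral>\<^sup>+y. h (x, y) \<partial>K x \<partial>L)"
proof -
  have "(\<integral>\<^sup>+z. h z \<partial>joint_law L N K)
      = (\<integral>\<^sup>+x. \<integral>\<^sup>+z. h z \<partial>(K x \<bind> (\<lambda>y. return (L \<Otimes>\<^sub>M N) (x, y))) \<partial>L)"
    unfolding joint_law_def
    by (rule nn_integral_bind[OF assms measurable_prob_algebraD[OF inner]])
  also have "\<dots> = (\<integral>\<^sup>+x. \<integral>\<^sup>+y. h (x, y) \<partial>K x \<partial>L)"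
  proof (rule nn_integral_cong)
    fix x assume x: "x \<in> space L"
    have sK: "sets (K x) = sets N"
      using measurable_space[OF K x] by (simp add: space_prob_algebra)
    then have spK: "space (K x) = space N" by (rule sets_eq_imp_space_eq)
    have "(\<lambda>y. return (L \<Otimes>\<^sub>M N) (x, y)) \<in> measurable (K x) (subprob_algebra (L \<Otimes>\<^sub>M N))"
      using x by (subst measurable_cong_sets[OF sK refl]) measurable
    then have "(\<integral>\<^sup>+z. h z \<partial>(K x \<bind> (\<lambda>y. return (L \<Otimes>\<^sub>M N) (x, y))))
        = (\<integral>\<^sup>+y. \<integral>\<^sup>+z. h z \<partial>return (L \<Otimes>\<^sub>M N) (x, y) \<partial>K x)"
      by (rule nn_integral_bind[OF assms])
    also have "\<dots> = (\<integral>\<^sup>+y. h (x, y) \<partial>K x)"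
      using x spK by (intro nn_integral_cong nn_integral_return) (auto simp: space_pair_measure)
    finally show "(\<integral>\<^sup>+z. h z \<partial>(K x \<bind> (\<lambda>y. return (L \<Otimes>\<^sub>M N) (x, y)))) = \<dots>" .
  qed
  finally show ?thesis .
qed

lemma distr_fst_joint_law: "distr (joint_law L N K) L fst = L"
proof (rule measure_eqI)
  fix B assume "B \<in> sets (distr (joint_law L N K) L fst)"
  then have [measurable]: "B \<in> sets L" by simp
  note [measurable_cong] = sets_joint_law
  have "emeasure (distr (joint_law L N K) L fst) B = (\<integral>\<^sup>+z. indicator B z \<partial>distr (joint_law L N K) L fst)"
    by simp
  also have "\<dots> = (\<integral>\<^sup>+z. indicator B (fst z) \<partial>joint_law L N K)"
    by (subst nn_integral_distr) auto
  also have "\<dots> = (\<integral>\<^sup>+x. \<integral>\<^sup>+y. indicator B x \<partial>K x \<partial>L)"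
    by (subst nn_integral_joint_law) auto
  also have "\<dots> = (\<integral>\<^sup>+x. indicator B x \<partial>L)"
    using measurable_space[OF K]
    by (intro nn_integral_cong) (auto simp: space_prob_algebra prob_space.emeasure_space_1)
  also have "\<dots> = emeasure L B" by simp
  finally show "emeasure (distr (joint_law L N K) L fst) B = emeasure L B" .
qed simp

end

section \<open>Conditional entropy of the quantizer given the state\<close>

context rsuq_setup begin

text \<open>By independence, freezing the state yields a regular conditional law of the output. As
  \<open>cond_entropy\<close> is an infimum over such laws, this one gives an upper bound; its
  entropy at each state is estimated by \<open>shannon_entropy_distr_le\<close>, with the grid as
  countable support.\<close>

lemma cond_entropy_le:
  assumes M: "prob_space M" and X[measurable]: "X \<in> borel_measurable M"
    and S[measurable]: "S \<in> measurable M state_space" and SL: "distr M state_space S = L"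
    and indep: "prob_space.indep_set M {X -` B \<inter> space M |B. B \<in> sets borel}
                              {S -` B \<inter> space M |B. B \<in> sets state_space}"
  shows "cond_entropy M state_space (\<lambda>\<omega>. rsuq G P A (X \<omega>) (S \<omega>)) S
    \<le> (\<integral>\<^sup>+s. \<integral>\<^sup>+x. ennreal (- log 2 (measure (distr M borel X) {x'. rsuq G P A x' s = rsuq G P A x s}))
        \<partial>distr M borel X \<partial>L)"
proof -
  interpret M: prob_space M by fact
  define PX where "PX = distr M borel X"
  have sPX[measurable_cong, simp]: "sets PX = sets borel" and spPX[simp]: "space PX = UNIV"
    by (simp_all add: PX_def)
  interpret PX: prob_space PX unfolding PX_def by (rule M.prob_space_distr) simp
  interpret L: prob_space L by (rule prob_space_L)
  interpret LX: pair_prob_space L PX ..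
  define \<kappa> where "\<kappa> s = distr PX borel (\<lambda>x. rsuq G P A x s)" for s
  have "(\<lambda>_. PX) \<in> measurable state_space (prob_algebra borel)"
    using PX.prob_space_axioms by (intro measurable_const) (simp add: space_prob_algebra)
  then have \<kappa>[measurable]: "\<kappa> \<in> measurable state_space (prob_algebra borel)"
    unfolding \<kappa>_def[abs_def] by (rule measurable_distr_prob_space2) measurable
  \<comment> \<open>Independence as an identity of laws; checking rectangles is enough, both factors
    being sigma-finite.\<close>
  have LXeq: "L \<Otimes>\<^sub>M PX = distr M (state_space \<Otimes>\<^sub>M borel) (\<lambda>\<omega>. (S \<omega>, X \<omega>))"
  proof (rule pair_measure_eqI)
    show "sets (L \<Otimes>\<^sub>M PX) = sets (distr M (state_space \<Otimes>\<^sub>M borel) (\<lambda>\<omega>. (S \<omega>, X \<omega>)))"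
      by (simp add: sets_L cong: sets_pair_measure_cong)
    fix B C assume "B \<in> sets L" "C \<in> sets PX"
    then have B[measurable]: "B \<in> sets state_space" and C[measurable]: "C \<in> sets borel"
      by (simp_all add: sets_L)
    have "M.prob ((X -` C \<inter> space M) \<inter> (S -` B \<inter> space M))
        = M.prob (X -` C \<inter> space M) * M.prob (S -` B \<inter> space M)"
      using B C by (intro M.indep_setD[OF indep]) auto
    moreover have "(\<lambda>\<omega>. (S \<omega>, X \<omega>)) -` (B \<times> C) \<inter> space M = (X -` C \<inter> space M) \<inter> (S -` B \<inter> space M)"
      by auto
    ultimately have "emeasure (distr M (state_space \<Otimes>\<^sub>M borel) (\<lambda>\<omega>. (S \<omega>, X \<omega>))) (B \<times> C)
        = emeasure M (S -` B \<inter> space M) * emeasure M (X -` C \<inter> space M)"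
      by (simp add: emeasure_distr M.emeasure_eq_measure ennreal_mult mult.commute)
    then show "emeasure L B * emeasure PX C = emeasure (distr M (state_space \<Otimes>\<^sub>M borel) (\<lambda>\<omega>. (S \<omega>, X \<omega>))) (B \<times> C)"
      unfolding SL[symmetric] PX_def by (simp add: emeasure_distr)
  qed (rule L.sigma_finite_measure_axioms PX.sigma_finite_measure_axioms)+
  have sL: "sets (L \<Otimes>\<^sub>M borel) = sets (state_space \<Otimes>\<^sub>M borel)"
    by (intro sets_pair_measure_cong sets_L refl)
  have \<kappa>L: "\<kappa> \<in> measurable L (prob_algebra borel)" by measurable
  have "distr M (state_space \<Otimes>\<^sub>M borel) (\<lambda>\<omega>. (S \<omega>, rsuq G P A (X \<omega>) (S \<omega>))) = joint_law L borel \<kappa>"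
  proof (rule measure_eqI)
    fix B assume "B \<in> sets (distr M (state_space \<Otimes>\<^sub>M borel) (\<lambda>\<omega>. (S \<omega>, rsuq G P A (X \<omega>) (S \<omega>))))"
    then have [measurable]: "B \<in> sets (state_space \<Otimes>\<^sub>M borel)" by simp
    have BL: "B \<in> sets (joint_law L borel \<kappa>)"
      by (simp add: sets_joint_law[OF prob_space_L \<kappa>L] sL)
    have "emeasure (distr M (state_space \<Otimes>\<^sub>M borel) (\<lambda>\<omega>. (S \<omega>, rsuq G P A (X \<omega>) (S \<omega>)))) B
        = (\<integral>\<^sup>+w. indicator B w \<partial>distr M (state_space \<Otimes>\<^sub>M borel) (\<lambda>\<omega>. (S \<omega>, rsuq G P A (X \<omega>) (S \<omega>))))"
      by simp
    also have "\<dots> = (\<integral>\<^sup>+\<omega>. indicator B (S \<omega>, rsuq G P A (X \<omega>) (S \<omega>)) \<partial>M)"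
      by (subst nn_integral_distr) auto
    also have "\<dots> = (\<integral>\<^sup>+w. indicator B (fst w, rsuq G P A (snd w) (fst w)) \<partial>(L \<Otimes>\<^sub>M PX))"
      unfolding LXeq by (subst nn_integral_distr) auto
    also have "\<dots> = (\<integral>\<^sup>+s. \<integral>\<^sup>+x. indicator B (s, rsuq G P A x s) \<partial>PX \<partial>L)"
      by (subst PX.nn_integral_fst[symmetric]) auto
    also have "\<dots> = (\<integral>\<^sup>+s. \<integral>\<^sup>+y. indicator B (s, y) \<partial>\<kappa> s \<partial>L)"
      unfolding \<kappa>_def by (intro nn_integral_cong, subst nn_integral_distr) auto
    also have "\<dots> = (\<integral>\<^sup>+w. indicator B w \<partial>joint_law L borel \<kappa>)"
      by (intro nn_integral_joint_law[symmetric] prob_space_L \<kappa>L) measurable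
    also have "\<dots> = emeasure (joint_law L borel \<kappa>) B"
      using BL by simp
    finally show "emeasure (distr M (state_space \<Otimes>\<^sub>M borel) (\<lambda>\<omega>. (S \<omega>, rsuq G P A (X \<omega>) (S \<omega>)))) B
      = emeasure (joint_law L borel \<kappa>) B" .
  qed (simp add: sets_joint_law[OF prob_space_L \<kappa>L] sL)
  then have "\<kappa> \<in> cond_laws M state_space (\<lambda>\<omega>. rsuq G P A (X \<omega>) (S \<omega>)) S"
    using \<kappa> by (simp add: cond_laws_def SL)
  then have "cond_entropy M state_space (\<lambda>\<omega>. rsuq G P A (X \<omega>) (S \<omega>)) S \<le> (\<integral>\<^sup>+s. shannon_entropy (\<kappa> s) \<partial>L)"
    unfolding cond_entropy_def SL by (rule INF_lower)
  also have "\<dots> \<le> (\<integral>\<^sup>+s. \<integral>\<^sup>+x. ennreal (- log 2 (measure PX {x'. rsuq G P A x' s = rsuq G P A x s})) \<partial>PX \<partial>L)"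
  proof (rule nn_integral_mono)
    fix s
    have "shannon_entropy (\<kappa> s)
        \<le> (\<integral>\<^sup>+x. ennreal (- log 2 (measure PX {x' \<in> space PX. rsuq G P A x' s = rsuq G P A x s})) \<partial>PX)"
      unfolding \<kappa>_def
    proof (rule shannon_entropy_distr_le)
      show "countable (range (\<lambda>(k, j). s k + lattice_pt G j))" by simp
      fix x
      show "rsuq G P A x s \<in> range (\<lambda>(k, j). s k + lattice_pt G j)"
        using rsuq_grid[of x s] by (auto intro: image_eqI[where x="(accept_index x s, _)"])
    qed (auto intro: PX.prob_space_axioms)
    then show "shannon_entropy (\<kappa> s)
        \<le> (\<integral>\<^sup>+x. ennreal (- log 2 (measure PX {x'. rsuq G P A x' s = rsuq G P A x s})) \<partial>PX)"
      by simp
  qed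
  finally show ?thesis unfolding PX_def .
qed

end

section \<open>Passage to the infimum over test channels\<close>

theorem theorem11:
  fixes G :: "real^'n^'n"
    and P A :: "(real^'n) set"
    and d :: "real^'n \<Rightarrow> real"
    and M :: "'w measure"
    and X :: "'w \<Rightarrow> real^'n"
    and S :: "'w \<Rightarrow> nat \<Rightarrow> real^'n"
  defines "Q \<equiv> \<lambda>\<omega>. rsuq G P A (X \<omega>) (S \<omega>)"
  defines "p \<equiv> measure lborel A / measure lborel P"
  defines "D \<equiv> (\<integral>\<^sup>+\<omega>. ennreal (d (Q \<omega> - X \<omega>)) \<partial>M)"
  assumes "rank G = CARD('n)"
    and "basic_cell G P" and "P \<in> sets borel"
    and "A \<subseteq> P" and "A \<in> sets borel" and "emeasure lborel A > 0"
    and "d \<in> borel_measurable borel" and "\<And>x. 0 \<le> d x"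
    and "prob_space M"
    and "X \<in> borel_measurable M"
    and "S \<in> measurable M state_space"
    and "distr M state_space S = rsuq_state P"
    and "prob_space.indep_set M {X -` B \<inter> space M |B. B \<in> sets borel}
                              {S -` B \<inter> space M |B. B \<in> sets state_space}"
  shows "enn2ereal (cond_entropy M state_space Q S)
           \<le> rate_distortion (distr M borel X) d D - ereal (log 2 p)
              + capacity_term A d D + ereal (log 2 (exp 1))"
proof -
  interpret rsuq_setup G P A by standard fact+
  interpret M: prob_space M by fact
  note [measurable] = \<open>X \<in> borel_measurable M\<close> \<open>d \<in> borel_measurable borel\<close>
  define PX where "PX = distr M borel X"
  have PX: "prob_space PX" "sets PX = sets borel"
    unfolding PX_def by (auto intro: M.prob_space_distr)
  note [measurable_cong] = PX(2)
  let ?e = "ereal (log 2 (exp 1))"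
  define H where "H = enn2ereal (cond_entropy M state_space Q S)"
  \<comment> \<open>The second conjunct serves the extended arithmetic below: an admissible channel
    supplies a \<open>T\<close> with nonnegative information, so the capacity term is not
    -\<infinity>.\<close>
  have bound: "H \<le> mutual_info (joint_law PX borel K) borel borel fst snd + capacity_term A d D + ?e
      \<and> capacity_term A d D \<noteq> -\<infinity>"
    if K: "K \<in> measurable borel (prob_algebra borel)"
      and KD: "(\<integral>\<^sup>+z. ennreal (d (snd z - fst z)) \<partial>joint_law PX borel K) \<le> D" for K
  proof -
    define J where "J = joint_law PX borel K"
    have K': "K \<in> measurable PX (prob_algebra borel)" using K by measurable
    have sJ: "sets J = sets (borel \<Otimes>\<^sub>M borel)"
      using sets_joint_law[OF PX(1) K'] PX(2) by (simp add: J_def cong: sets_pair_measure_cong)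
    have "prob_space J" unfolding J_def by (rule prob_space_joint_law[OF PX(1) K'])
    then interpret C: rsuq_coupling G P A J
      using sJ by (intro rsuq_coupling.intro rsuq_coupling_axioms.intro rsuq_setup_axioms)
    have CX: "C.PX = PX"
      using distr_fst_joint_law[OF PX(1) K'] PX(2) unfolding C.PX_def unfolding J_def by (simp cong: distr_cong)
    have "distr J (borel \<Otimes>\<^sub>M borel) (\<lambda>z. (fst z, snd z)) = J"
      using distr_id2[OF sJ[symmetric]] by simp
    then have mi: "mutual_info J borel borel fst snd = kl_div (C.PX \<Otimes>\<^sub>M C.PY) J"
      by (simp add: mutual_info_def C.PX_def C.PY_def)
    let ?B = "enn2ereal (\<integral>\<^sup>+t. \<integral>\<^sup>+z. ennreal (- log 2 (measure lborel A * noise_density C.PT (t + z))) \<partial>Z \<partial>C.PT)"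
    have "(\<integral>\<^sup>+t. ennreal (d (- t)) \<partial>C.PT) = (\<integral>\<^sup>+z. ennreal (d (snd z - fst z)) \<partial>J)"
      unfolding C.PT_def by (subst nn_integral_distr) auto
    \<comment> \<open>Since \<open>- T = Y - X\<close>, the distortion bound of the channel makes
      the law of \<open>T\<close> a competitor in the supremum.\<close>
    with KD have "(\<integral>\<^sup>+t. ennreal (d (- t)) \<partial>C.PT) \<le> D" by (simp add: J_def)
    then have "mutual_info (C.PT \<Otimes>\<^sub>M Z) borel borel fst (\<lambda>(t, z). t + z) \<le> capacity_term A d D"
      unfolding capacity_term_def using C.prob_space_marginals(3) by (intro SUP_upper) auto
    with mutual_info_noise_ge[OF C.prob_space_marginals(3) C.sets_marginals(3)]
    have B: "?B \<le> capacity_term A d D" by (rule order_trans)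
    have "0 \<le> ?B" by simp
    with B have C0: "capacity_term A d D \<noteq> -\<infinity>" by (auto simp: ereal_infty_less_eq2)
    have H: "H \<le> enn2ereal (\<integral>\<^sup>+s. \<integral>\<^sup>+x. ennreal (- log 2 (C.atom x s)) \<partial>C.PX \<partial>L)"
      unfolding H_def Q_def C.atom_def C.mass_def CX unfolding PX_def
      using cond_entropy_le[OF \<open>prob_space M\<close> \<open>X \<in> borel_measurable M\<close>
        \<open>S \<in> measurable M state_space\<close> \<open>distr M state_space S = rsuq_state P\<close>] assms
      by (simp add: less_eq_ennreal.rep_eq[symmetric])
    have "H \<le> mutual_info J borel borel fst snd + capacity_term A d D + ?e"
    proof (cases "absolutely_continuous (C.PX \<Otimes>\<^sub>M C.PY) J \<and>
        integrable J (entropy_density 2 (C.PX \<Otimes>\<^sub>M C.PY) J)")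
      case True
      then have "H \<le> ereal (KL_divergence 2 (C.PX \<Otimes>\<^sub>M C.PY) J) + ?B + ?e"
        using C.entropy_bound H by (blast intro: order_trans)
      also have "\<dots> \<le> ereal (KL_divergence 2 (C.PX \<Otimes>\<^sub>M C.PY) J) + capacity_term A d D + ?e"
        by (intro add_mono B order_refl)
      finally show ?thesis
        using True by (simp add: mi kl_div_def)
    next
      case False
      then have "mutual_info J borel borel fst snd = \<infinity>"
        unfolding mi kl_div_def by (simp only: if_False)
      then show ?thesis by simp
    qed
    with C0 show ?thesis unfolding J_def by blast
  qed
  have logp: "ereal (log 2 p) \<le> 0"
    using log2_nonpos[of accept_prob] accept_prob_pos accept_prob_le_1 unfolding p_def accept_prob_def by simp
  have "H \<le> rate_distortion PX d D + capacity_term A d D + ?e"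
  proof (cases "capacity_term A d D")
    case PInf
    then show ?thesis by simp
  next
    case MInf
    \<comment> \<open>By \<open>bound\<close> no channel is admissible, and the infimum of the empty
      set is \<infinity>; in \<open>ereal\<close> it absorbs the capacity -\<infinity>.\<close>
    then have "rate_distortion PX d D = \<infinity>"
      using bound unfolding rate_distortion_def by (auto simp: top_ereal_def[symmetric])
    then show ?thesis by simp
  next
    case (real c)
    \<comment> \<open>Finite constants are moved to the left so that the bound for every channel
      passes to the infimum.\<close>
    have "H - ereal c - ?e \<le> rate_distortion PX d D"
      unfolding rate_distortion_def
    proof (rule INF_greatest)
      fix K assume "K \<in> {K \<in> measurable borel (prob_algebra borel).
                 (\<integral>\<^sup>+z. ennreal (d (snd z - fst z)) \<partial>joint_law PX borel K) \<le> D}"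
      then have "H \<le> mutual_info (joint_law PX borel K) borel borel fst snd + ereal c + ?e"
        using bound[of K] real by simp
      then show "H - ereal c - ?e \<le> mutual_info (joint_law PX borel K) borel borel fst snd"
        by (simp add: ereal_minus_le add.commute add.left_commute)
    qed
    then show ?thesis
      using real by (cases "rate_distortion PX d D"; cases H) auto
  qed
  \<comment> \<open>The added term - log p is nonnegative because the acceptance probability is at
    most 1.\<close>
  also have "\<dots> \<le> rate_distortion PX d D - ereal (log 2 p) + capacity_term A d D + ?e"
    using logp by (intro add_right_mono) (cases "rate_distortion PX d D", auto)
  finally show ?thesis unfolding H_def PX_def .
qed

end
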